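(* Let $\mu$ be a probability measure on $\mathbb{R}$ with infinite support and all moments finite, and for $n\in\mathbb{N}$ let $\mu_n^R$ be its $n$-th reversed measure (a probability measure with exactly $n+1$ support points, see context). Consider the property: (P) There is a point $x_0\in\mathbb{R}$, independent of $n$, such that for all $n\in\mathbb{N}$: - if $n=2m-1$ is odd, then $\mu_n^R$ has equal masses at all of its $n+1$ support points; - if $n=2m$ is even, then $\mu_n^R$ has equal masses at $n$ of its support points and has positive mass at the point $x_0$ (the remaining support point). For $\gamma>-1$ let $\xi_\gamma$ be the probability measure on $\mathbb{R}$ with density proportional to $|x|^\gamma \exp(-x^2)$, i.e. the normalized orthogonality measure of the generalized Hermite polynomials $H_n^{(\gamma)}(x)$. Then the generalized Hermite polynomials are characterized, uniquely up to a linear transformation, by (P): the measure $\mu$ satisfies (P) if and only if there are $\gamma>-1$, $c>0$ and $d\in\mathbb{R}$ such that $\mu$ has density proportional to $|c(x-d)|^\gamma\exp(-c^2(x-d)^2)$. Moreover, for every $\gamma>-1$ and all $m\in\mathbb{N}$, the point $0$ is a support point of $\xi_{\gamma,2m}^R$ (the $2m$-th reversed measure of $\xi_\gamma$), and the weight of $\xi_{\gamma,2m}^R$ at $0$ equals $\gamma+1$ times the (equal) weight of $\xi_{\gamma,2m}^R$ at each of the remaining $2m$ support points.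
   Context: For a probability measure $\mu$ on $\mathbb{R}$ with infinite support and all moments finite, the Stieltjes transform has the (formal) continued fraction expansion $$\int_{-\infty}^{\infty}\frac{d\mu(x)}{z-x}=\cfrac{1}{z-b_1-\cfrac{a_1}{z-b_2-\cfrac{a_2}{z-b_3-\cdots}}},\qquad a_i>0,\ b_i\in\mathbb{R},$$ where the $a_i,b_i$ are the recurrence coefficients of the monic orthogonal polynomials of $\mu$: $P_{-1}=0$, $P_0=1$, $P_{n+1}(x)=(x-b_{n+1})P_n(x)-a_nP_{n-1}(x)$. The $n$-th reversed measure $\mu_n^R$ is the probability measure, with $n+1$ support points, determined by $$\int_{-\infty}^{\infty}\frac{d\mu_n^R(x)}{z-x}=\cfrac{1}{z-b_{n+1}-\cfrac{a_n}{z-b_n-\cfrac{a_{n-1}}{\ddots-\cfrac{a_1}{z-b_1}}}}.$$ Here $\mathbb{N}=\{1,2,\dots\}$. *)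

theory Defs
  imports "HOL-Probability.Probability" "HOL-Computational_Algebra.Polynomial"
begin

definition measure_support :: "real measure \<Rightarrow> real set" where
  "measure_support M = {x. \<forall>U. open U \<and> x \<in> U \<longrightarrow> emeasure M U > 0}"

definition prob_on_reals :: "real measure \<Rightarrow> bool" where
  "prob_on_reals M \<longleftrightarrow> prob_space M \<and> sets M = sets borel"

definition infinite_support_finite_moments :: "real measure \<Rightarrow> bool" where
  "infinite_support_finite_moments \<mu> \<longleftrightarrow>
     infinite (measure_support \<mu>) \<and> (\<forall>k::nat. integrable \<mu> (\<lambda>x. x ^ k))"

definition monic_orthogonal_polys :: "real measure \<Rightarrow> (nat \<Rightarrow> real poly) \<Rightarrow> bool" where
  "monic_orthogonal_polys \<mu> P \<longleftrightarrow>
     (\<forall>n. degree (P n) = n \<and> lead_coeff (P n) = 1) \<and>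
     (\<forall>m n. m \<noteq> n \<longrightarrow> (\<integral>x. poly (P m) x * poly (P n) x \<partial>\<mu>) = 0)"

text \<open>The coefficients are indexed from 1; the values \<open>a 0\<close> and \<open>b 0\<close> are irrelevant.
  The conditional encodes the convention that the polynomial of index $-1$ is zero.\<close>

definition recurrence_coeffs :: "real measure \<Rightarrow> (nat \<Rightarrow> real) \<Rightarrow> (nat \<Rightarrow> real) \<Rightarrow> bool" where
  "recurrence_coeffs \<mu> a b \<longleftrightarrow>
     (\<exists>P. monic_orthogonal_polys \<mu> P \<and>
          (\<forall>n. P (n + 1) = [:- b (n + 1), 1:] * P n
                 - (if n = 0 then 0 else smult (a n) (P (n - 1)))))"

text \<open>\<open>reversed_cf a b n z\<close> is the finite continued fraction
  \<open>1 / (z - b\<^sub>n\<^sub>+\<^sub>1 - a\<^sub>n / (z - b\<^sub>n - \<dots> - a\<^sub>1 / (z - b\<^sub>1)))\<close>.\<close>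

fun reversed_cf :: "(nat \<Rightarrow> real) \<Rightarrow> (nat \<Rightarrow> real) \<Rightarrow> nat \<Rightarrow> complex \<Rightarrow> complex" where
  "reversed_cf a b 0 z = 1 / (z - of_real (b 1))"
| "reversed_cf a b (Suc n) z =
     1 / (z - of_real (b (n + 2)) - of_real (a (n + 1)) * reversed_cf a b n z)"

text \<open>The defining identity is imposed for all non-real \<open>z\<close>, where neither the integrand nor
  the continued fraction has a vanishing denominator.\<close>

definition is_reversed_measure :: "real measure \<Rightarrow> nat \<Rightarrow> real measure \<Rightarrow> bool" where
  "is_reversed_measure \<mu> n \<nu> \<longleftrightarrow>
     prob_on_reals \<nu> \<and> card (measure_support \<nu>) = n + 1 \<and>
     (\<exists>a b. recurrence_coeffs \<mu> a b \<and>
        (\<forall>z. Im z \<noteq> 0 \<longrightarrow>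
           (\<integral>x. 1 / (z - complex_of_real x) \<partial>\<nu>) = reversed_cf a b n z))"

definition reversed_measure :: "real measure \<Rightarrow> nat \<Rightarrow> real measure" where
  "reversed_measure \<mu> n = (THE \<nu>. is_reversed_measure \<mu> n \<nu>)"

text \<open>For even \<open>n\<close>, the point \<open>x\<^sub>0\<close> is the support point that remains besides the \<open>n\<close> points of
  equal mass; its own mass may or may not differ from theirs.\<close>

definition property_P :: "real measure \<Rightarrow> bool" where
  "property_P \<mu> \<longleftrightarrow>
     (\<exists>x0. \<forall>n\<ge>1.
        let \<nu> = reversed_measure \<mu> n; S = measure_support \<nu> in
          (odd n \<longrightarrow> card S = n + 1 \<and> (\<exists>w. \<forall>x\<in>S. measure \<nu> {x} = w)) \<and>
          (even n \<longrightarrow> x0 \<in> S \<and> measure \<nu> {x0} > 0 \<and>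
             card (S - {x0}) = n \<and> (\<exists>w. \<forall>x\<in>S - {x0}. measure \<nu> {x} = w)))"

definition has_density_proportional_to :: "real measure \<Rightarrow> (real \<Rightarrow> real) \<Rightarrow> bool" where
  "has_density_proportional_to \<mu> g \<longleftrightarrow>
     (\<exists>K>0. \<mu> = density lborel (\<lambda>x. ennreal (K * g x)))"

definition gen_hermite_weight :: "real \<Rightarrow> real \<Rightarrow> real" where
  "gen_hermite_weight \<gamma> x = \<bar>x\<bar> powr \<gamma> * exp (- x\<^sup>2)"

definition gen_hermite_measure :: "real \<Rightarrow> real measure" where
  "gen_hermite_measure \<gamma> =
     density lborel (\<lambda>x. ennreal (gen_hermite_weight \<gamma> x / (\<integral>y. gen_hermite_weight \<gamma> y \<partial>lborel)))"

end

theory Submission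
  imports Defs "HOL-Computational_Algebra.Fundamental_Theorem_Algebra" "HOL-Real_Asymp.Real_Asymp"
begin

text \<open>
  The reversed continued fraction is \<open>P\<^sub>n / P\<^sub>n\<^sub>+\<^sub>1\<close>, so the reversed measure sits on the (real, simple)
  zeros of \<open>P\<^sub>n\<^sub>+\<^sub>1\<close> with masses \<open>P\<^sub>n / P'\<^sub>n\<^sub>+\<^sub>1\<close>. Equal masses for odd \<open>n = 2m - 1\<close> therefore mean
  \<open>P'\<^sub>2\<^sub>m = 2m P\<^sub>2\<^sub>m\<^sub>-\<^sub>1\<close>. Together with \<open>P\<^sub>2\<^sub>m\<^sub>+\<^sub>1(x\<^sub>0) = 0\<close> and the recurrence this forces \<open>b\<^sub>n = x\<^sub>0\<close>,
  \<open>a\<^sub>2\<^sub>m = 2m s\<close> and \<open>a\<^sub>2\<^sub>m\<^sub>+\<^sub>1 = (2m + 1 + \<gamma>) s\<close>. Conversely these coefficients give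
  \<open>(x - x\<^sub>0) P'\<^sub>2\<^sub>m\<^sub>+\<^sub>1 = (2m + 1 + \<gamma>) (x - x\<^sub>0) P\<^sub>2\<^sub>m - \<gamma> P\<^sub>2\<^sub>m\<^sub>+\<^sub>1\<close>, from which all masses are read off.
  Integration by parts shows that the rescaled generalized Hermite measures have exactly these
  coefficients, and such a measure is determined by its moments because it has exponential moments.
\<close>

section \<open>Polynomials satisfying a three-term recurrence\<close>

text \<open>Positivity of the \<open>a n\<close> carries the first half. It comes from the infinite
  support, since \<open>a n\<close> is a quotient of integrals of squares, and Wronskian-type
  inductions turn it into real zeros, simple zeros and positive masses. As
  \<open>reversed_measure\<close> is a definite description, nothing can be said about it before
  existence and uniqueness are settled. Existence is a partial fraction expansion. Uniqueness
  recovers each atom as a limit of i e G(y + i e) for e -> 0, where G is the Stieltjes transform;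
  atoms suffice because the support is finite. (P) leaves exactly x_0, a_1 and a_2 free: s = a_2 / 2
  fixes the scale and gamma = a_1 / s - 1, so gamma > -1 is the condition a_1 > 0. (P) is silent
  about n = 0, so P_1(x_0) = 0 is not given; this is why the first few b_n need an argument of their
  own. No explicit formula for generalized Hermite polynomials occurs. Integration by parts shows
  that the weight integrates every P_n with n >= 1 to zero, and the recurrence upgrades this to
  orthogonality. Equal orthogonal polynomials then mean equal moments.\<close>

fun recurrence_poly :: "(nat \<Rightarrow> real) \<Rightarrow> (nat \<Rightarrow> real) \<Rightarrow> nat \<Rightarrow> real poly" where
  "recurrence_poly a b 0 = 1"
| "recurrence_poly a b (Suc 0) = [:- b 1, 1:]"
| "recurrence_poly a b (Suc (Suc n)) =
     [:- b (n + 2), 1:] * recurrence_poly a b (Suc n) - smult (a (n + 1)) (recurrence_poly a b n)"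

lemma recurrence_poly_monic:
  "degree (recurrence_poly a b n) = n \<and> lead_coeff (recurrence_poly a b n) = 1"
proof (induction a b n rule: recurrence_poly.induct)
  case (3 a b k)
  let ?P = "recurrence_poly a b"
  have IH: "degree (?P (Suc k)) = Suc k" "lead_coeff (?P (Suc k)) = 1" "degree (?P k) = k"
    using 3 by blast+
  have nz: "?P (Suc k) \<noteq> 0"
    using IH by force
  have d: "degree ([:- b (k + 2), 1:] * ?P (Suc k)) = Suc (Suc k)"
    using nz IH by (subst degree_mult_eq) auto
  have l: "lead_coeff ([:- b (k + 2), 1:] * ?P (Suc k)) = 1"
    by (subst lead_coeff_mult) (use IH in auto)
  have s: "degree (smult (a (k + 1)) (?P k)) < Suc (Suc k)"
    using IH degree_smult_le[of "a (k+1)" "?P k"] by simp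
  have deg: "degree (?P (Suc (Suc k))) = Suc (Suc k)"
    unfolding recurrence_poly.simps(3) diff_conv_add_uminus
    by (subst degree_add_eq_left) (use d s in \<open>simp_all del: mult_pCons_left\<close>)
  moreover have "coeff (?P (Suc (Suc k))) (Suc (Suc k)) = 1"
    unfolding recurrence_poly.simps(3) coeff_diff using l d IH coeff_eq_0[of "?P k" "Suc (Suc k)"]
    by (simp del: mult_pCons_left)
  ultimately show ?case by simp
qed auto

lemma degree_recurrence_poly [simp]: "degree (recurrence_poly a b n) = n"
  and coeff_recurrence_poly [simp]: "coeff (recurrence_poly a b n) n = 1"
  using recurrence_poly_monic[of a b n] by auto

lemma recurrence_poly_neq_0 [simp]: "recurrence_poly a b n \<noteq> 0"
  by (metis coeff_0 coeff_recurrence_poly zero_neq_one)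

lemma recurrence_poly_unique:
  assumes "P 0 = 1"
    and "\<And>n. P (n + 1) = [:- b (n + 1), 1:] * P n - (if n = 0 then 0 else smult (a n) (P (n - 1)))"
  shows "P = recurrence_poly a b"
proof
  fix n
  have "P n = recurrence_poly a b n \<and> P (Suc n) = recurrence_poly a b (Suc n)"
  proof (induction n)
    case 0
    thus ?case using assms(1) assms(2)[of 0] by simp
  next
    case (Suc n)
    thus ?case using assms(2)[of "Suc n"] by (simp add: recurrence_poly.simps(3))
  qed
  thus "P n = recurrence_poly a b n" ..
qed

declare recurrence_poly.simps(3) [simp del]

text \<open>The indices are linked by equations so that the rule applies to terms such as
  \<open>2 * k + 3\<close>, which are not syntactic successors.\<close>

lemma poly_recurrence_poly_rec:
  assumes "m = Suc n" "l = Suc m"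
  shows "poly (recurrence_poly a b l) x =
     (x - b l) * poly (recurrence_poly a b m) x - a m * poly (recurrence_poly a b n) x"
  using assms by (simp add: recurrence_poly.simps(3) algebra_simps)

lemma poly_pderiv_recurrence_poly_rec:
  assumes "m = Suc n" "l = Suc m"
  shows "poly (pderiv (recurrence_poly a b l)) x =
     poly (recurrence_poly a b m) x + (x - b l) * poly (pderiv (recurrence_poly a b m)) x
     - a m * poly (pderiv (recurrence_poly a b n)) x"
  using assms
  by (simp add: recurrence_poly.simps(3) pderiv_diff pderiv_add pderiv_mult pderiv_smult pderiv_pCons
       algebra_simps)

text \<open>Confluent Christoffel-Darboux: the Wronskians satisfy W_{n+1} = P_{n+1}^2 + a_{n+1} W_n
  with W_0 = 1. At a zero of P_{n+1} this leaves P_{n+1}' P_n > 0, which gives simple zeros, no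
  common zeros of neighbours, and positive residues.\<close>

lemma recurrence_poly_wronskian_pos:
  assumes "\<And>n. n \<ge> 1 \<Longrightarrow> a n > 0"
  shows "poly (pderiv (recurrence_poly a b (Suc n))) x * poly (recurrence_poly a b n) x
         - poly (pderiv (recurrence_poly a b n)) x * poly (recurrence_poly a b (Suc n)) x > 0"
proof (induction n)
  case (Suc n)
  let ?p = "\<lambda>n. poly (recurrence_poly a b n) x"
  let ?q = "\<lambda>n. poly (pderiv (recurrence_poly a b n)) x"
  have p: "?p (Suc (Suc n)) = (x - b (Suc (Suc n))) * ?p (Suc n) - a (Suc n) * ?p n"
    by (rule poly_recurrence_poly_rec) simp_all
  have q: "?q (Suc (Suc n)) = ?p (Suc n) + (x - b (Suc (Suc n))) * ?q (Suc n) - a (Suc n) * ?q n"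
    by (rule poly_pderiv_recurrence_poly_rec) simp_all
  have "?q (Suc (Suc n)) * ?p (Suc n) - ?q (Suc n) * ?p (Suc (Suc n))
      = ?p (Suc n) ^ 2 + a (Suc n) * (?q (Suc n) * ?p n - ?q n * ?p (Suc n))"
    unfolding p q by (simp add: algebra_simps power2_eq_square)
  moreover have "a (Suc n) > 0"
    using assms by simp
  ultimately show ?case
    using Suc.IH by (metis add_nonneg_pos mult_pos_pos zero_le_power2)
qed (simp add: pderiv_pCons)

section \<open>Passage to complex arguments and the continued fraction\<close>

abbreviation cpoly :: "real poly \<Rightarrow> complex poly" where
  "cpoly \<equiv> map_poly complex_of_real"

lemma cpoly_hom:
  "cpoly (p + q) = cpoly p + cpoly q"
  "cpoly (p - q) = cpoly p - cpoly q"
  "cpoly (smult c p) = smult (of_real c) (cpoly p)"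
  "cpoly 1 = 1"
  "cpoly (pCons c p) = pCons (of_real c) (cpoly p)"
  "cpoly (pderiv p) = pderiv (cpoly p)"
  "degree (cpoly p) = degree p"
  by (auto simp: poly_eq_iff coeff_map_poly coeff_pderiv coeff_pCons degree_map_poly split: nat.splits)

lemma cpoly_mult: "cpoly (p * q) = cpoly p * cpoly q"
  by (induction p) (simp_all add: cpoly_hom mult_pCons_left)

lemma cpoly_sum: "cpoly (sum f A) = (\<Sum>x\<in>A. cpoly (f x))"
  by (induction A rule: infinite_finite_induct) (simp_all add: cpoly_hom)

lemma cpoly_prod: "cpoly (prod f A) = (\<Prod>x\<in>A. cpoly (f x))"
  by (induction A rule: infinite_finite_induct) (simp_all add: cpoly_hom cpoly_mult)

lemma poly_cpoly_of_real: "poly (cpoly p) (of_real x) = of_real (poly p x)"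
  by (induction p) (simp_all add: cpoly_hom)

lemma poly_cpoly_recurrence_poly_Suc_Suc:
  "poly (cpoly (recurrence_poly a b (Suc (Suc n)))) z =
     (z - of_real (b (n + 2))) * poly (cpoly (recurrence_poly a b (Suc n))) z
     - of_real (a (n + 1)) * poly (cpoly (recurrence_poly a b n)) z"
  by (simp add: recurrence_poly.simps(3) cpoly_hom cpoly_mult algebra_simps del: mult_pCons_left)

text \<open>Sesquilinear version of the Wronskian argument: Im(P_{n+1}(z) cnj(P_n(z))) / Im z obeys
  the same kind of recursion, with the square |P_{n+1}(z)|^2, and stays positive, so no factor
  vanishes.\<close>

lemma recurrence_poly_nonreal_nonzero:
  assumes "\<And>n. n \<ge> 1 \<Longrightarrow> a n > 0" and "Im z \<noteq> 0"
  shows "poly (cpoly (recurrence_poly a b n)) z \<noteq> 0"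
proof -
  let ?c = "\<lambda>n. poly (cpoly (recurrence_poly a b n)) z"
  have "Im (?c (Suc n) * cnj (?c n)) / Im z > 0" for n
  proof (induction n)
    case 0
    show ?case
      using assms(2) by (simp add: cpoly_hom)
  next
    case (Suc n)
    have "Im (?c (Suc (Suc n)) * cnj (?c (Suc n)))
        = Im z * (cmod (?c (Suc n)))^2 + a (n + 1) * Im (?c (Suc n) * cnj (?c n))"
      unfolding poly_cpoly_recurrence_poly_Suc_Suc cmod_power2
      by (simp add: algebra_simps power2_eq_square)
    hence "Im (?c (Suc (Suc n)) * cnj (?c (Suc n))) / Im z
        = (cmod (?c (Suc n)))^2 + a (n + 1) * (Im (?c (Suc n) * cnj (?c n)) / Im z)"
      using assms(2) by (simp add: field_simps)
    moreover have "a (n + 1) > 0"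
      using assms by simp
    ultimately show ?case
      using Suc.IH by (metis add_nonneg_pos mult_pos_pos zero_le_power2)
  qed
  from this[of n] show ?thesis by auto
qed

text \<open>Dividing the recurrence for P_{n+2} by P_{n+1} produces one layer of the fraction; all
  denominators are nonzero off the real line.\<close>

lemma reversed_cf_eq:
  assumes "\<And>n. n \<ge> 1 \<Longrightarrow> a n > 0" and "Im z \<noteq> 0"
  shows "reversed_cf a b n z =
    poly (cpoly (recurrence_poly a b n)) z / poly (cpoly (recurrence_poly a b (Suc n))) z"
proof (induction n)
  case 0
  show ?case by (simp add: cpoly_hom)
next
  case (Suc n)
  let ?c = "\<lambda>n. poly (cpoly (recurrence_poly a b n)) z"
  have nz: "?c k \<noteq> 0" for k
    using recurrence_poly_nonreal_nonzero[of a z, OF assms] by simp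
  have "?c (Suc (Suc n)) / ?c (Suc n)
      = (z - of_real (b (n + 2))) - of_real (a (n + 1)) * (?c n / ?c (Suc n))"
    unfolding poly_cpoly_recurrence_poly_Suc_Suc using nz by (simp add: field_simps)
  hence "reversed_cf a b (Suc n) z = 1 / (?c (Suc (Suc n)) / ?c (Suc n))"
    by (simp only: reversed_cf.simps Suc)
  thus ?case by simp
qed

section \<open>Zeros, residues and partial fractions\<close>

definition recurrence_roots :: "(nat \<Rightarrow> real) \<Rightarrow> (nat \<Rightarrow> real) \<Rightarrow> nat \<Rightarrow> real set" where
  "recurrence_roots a b n = {x. poly (recurrence_poly a b n) x = 0}"

text \<open>The residue of P_n / P_{n+1} at a simple zero \<open>x\<close> of P_{n+1}.\<close>

definition reversed_weight :: "(nat \<Rightarrow> real) \<Rightarrow> (nat \<Rightarrow> real) \<Rightarrow> nat \<Rightarrow> real \<Rightarrow> real" where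
  "reversed_weight a b n x =
     poly (recurrence_poly a b n) x / poly (pderiv (recurrence_poly a b (Suc n))) x"

lemma finite_recurrence_roots [simp]: "finite (recurrence_roots a b n)"
  unfolding recurrence_roots_def by (rule poly_roots_finite) simp

lemma reversed_weight_pos:
  assumes "\<And>n. n \<ge> 1 \<Longrightarrow> a n > 0" and "x \<in> recurrence_roots a b (Suc n)"
  shows "reversed_weight a b n x > 0"
proof -
  have "poly (pderiv (recurrence_poly a b (Suc n))) x * poly (recurrence_poly a b n) x > 0"
    using recurrence_poly_wronskian_pos[of a b n x] assms by (simp add: recurrence_roots_def)
  thus ?thesis
    by (auto simp: reversed_weight_def zero_less_mult_iff zero_less_divide_iff)
qed

lemma pderiv_recurrence_poly_root_nonzero:
  assumes "\<And>n. n \<ge> 1 \<Longrightarrow> a n > 0" and "poly (recurrence_poly a b n) x = 0"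
  shows "poly (pderiv (recurrence_poly a b n)) x \<noteq> 0"
proof (cases n)
  case (Suc k)
  thus ?thesis
    using recurrence_poly_wronskian_pos[of a b k x] assms by auto
qed (use assms in auto)

lemma recurrence_poly_consecutive_nonzero:
  assumes "\<And>n. n \<ge> 1 \<Longrightarrow> a n > 0" and "poly (recurrence_poly a b (Suc n)) x = 0"
  shows "poly (recurrence_poly a b n) x \<noteq> 0"
  using recurrence_poly_wronskian_pos[of a b n x] assms by auto

text \<open>Over the complex numbers P_n splits; the zeros are real by nonvanishing off the real
  line and simple by the Wronskian, so the product runs over real zeros only.\<close>

lemma cpoly_recurrence_poly_decompose:
  assumes a: "\<And>n. n \<ge> 1 \<Longrightarrow> a n > 0"
  shows "cpoly (recurrence_poly a b n) = (\<Prod>x\<in>recurrence_roots a b n. [:- of_real x, 1:])"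
proof -
  let ?P = "cpoly (recurrence_poly a b n)"
  have real: "z \<in> range of_real" if "poly ?P z = 0" for z
    using recurrence_poly_nonreal_nonzero[of a z b n] a that
    by (metis complex_is_Real_iff Reals_def)
  have "rsquarefree ?P"
    unfolding rsquarefree_roots
  proof (intro allI notI, elim conjE)
    fix z assume z: "poly ?P z = 0" "poly (pderiv ?P) z = 0"
    then obtain x where "z = of_real x" using real by blast
    thus False
      using z pderiv_recurrence_poly_root_nonzero[of a b n x] a
      by (simp add: cpoly_hom(6)[symmetric] poly_cpoly_of_real)
  qed
  from complex_poly_decompose_rsquarefree[OF this]
  have "?P = (\<Prod>z | poly ?P z = 0. [:- z, 1:])"
    by (simp add: cpoly_hom coeff_map_poly)
  also have "{z. poly ?P z = 0} = of_real ` recurrence_roots a b n"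
    using real by (fastforce simp: recurrence_roots_def poly_cpoly_of_real image_iff)
  finally show ?thesis
    by (simp add: prod.reindex inj_on_def)
qed

lemma recurrence_poly_decompose:
  assumes a: "\<And>n. n \<ge> 1 \<Longrightarrow> a n > 0"
  shows "recurrence_poly a b n = (\<Prod>x\<in>recurrence_roots a b n. [:- x, 1:])"
proof -
  have "cpoly (recurrence_poly a b n) = cpoly (\<Prod>x\<in>recurrence_roots a b n. [:- x, 1:])"
    by (simp add: cpoly_recurrence_poly_decompose[OF a] cpoly_prod cpoly_hom)
  thus ?thesis
    by (simp add: poly_eq_iff coeff_map_poly)
qed

lemma card_recurrence_roots:
  assumes a: "\<And>n. n \<ge> 1 \<Longrightarrow> a n > 0"
  shows "card (recurrence_roots a b n) = n"
proof -
  have "n = degree (\<Prod>x\<in>recurrence_roots a b n. [:- x, 1:])"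
    using recurrence_poly_decompose[of a b n] a degree_recurrence_poly[of a b n] by simp
  also have "\<dots> = card (recurrence_roots a b n)"
    by (subst degree_prod_eq_sum_degree) auto
  finally show ?thesis ..
qed

lemma degree_prod_linear: "degree (\<Prod>x\<in>A. [:- x, 1:]) = card A" for A :: "real set"
  by (subst degree_prod_eq_sum_degree) auto

lemma lead_coeff_prod_linear: "lead_coeff (\<Prod>x\<in>A. [:- x, 1:]) = 1" for A :: "real set"
  by (simp add: lead_coeff_prod)

text \<open>Lagrange interpolation of P_n at the zeros of P_{n+1}: both sides have degree at most n
  and agree at n + 1 points. Being free of denominators, the identity carries over to complex
  arguments.\<close>

lemma recurrence_poly_partial_fractions:
  assumes a: "\<And>n. n \<ge> 1 \<Longrightarrow> a n > 0"
  shows "recurrence_poly a b n = (\<Sum>x\<in>recurrence_roots a b (Suc n).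
           smult (reversed_weight a b n x) (\<Prod>y\<in>recurrence_roots a b (Suc n) - {x}. [:- y, 1:]))"
    (is "_ = ?F")
proof -
  let ?S = "recurrence_roots a b (Suc n)" and ?P = "recurrence_poly a b"
  have card: "card ?S = Suc n"
    using card_recurrence_roots a by blast
  have "poly (?P n - ?F) x = 0" if x: "x \<in> ?S" for x
  proof -
    let ?R = "\<lambda>x. \<Prod>y\<in>?S - {x}. [:- y, 1:]"
    have "?P (Suc n) = [:- x, 1:] * ?R x"
      using recurrence_poly_decompose[of a b "Suc n"] a x by (simp add: prod.remove)
    hence "poly (pderiv (?P (Suc n))) x = poly (?R x) x"
      by (simp add: pderiv_mult pderiv_pCons del: mult_pCons_left)
    moreover have "poly (pderiv (?P (Suc n))) x \<noteq> 0"
      using pderiv_recurrence_poly_root_nonzero[of a b "Suc n" x] a x by (simp add: recurrence_roots_def)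
    ultimately have 1: "reversed_weight a b n x * poly (?R x) x = poly (?P n) x"
      by (simp add: reversed_weight_def)
    have "poly ?F x = (\<Sum>u\<in>?S. reversed_weight a b n u * poly (?R u) x)"
      by (simp add: poly_sum)
    \<comment> \<open>For u different from x the product still contains the factor vanishing at
      x.\<close>
    also have "\<dots> = (\<Sum>u\<in>{x}. reversed_weight a b n u * poly (?R u) x)"
      by (rule sum.mono_neutral_right) (use x in \<open>auto simp: poly_prod\<close>)
    finally show ?thesis
      using 1 by simp
  qed
  hence sub: "?S \<subseteq> {x. poly (?P n - ?F) x = 0}"
    by blast
  have "degree ?F \<le> n"
    by (intro degree_sum_le order.trans[OF degree_smult_le]) (auto simp: degree_prod_linear card)
  hence "degree (?P n - ?F) \<le> n"
    by (intro degree_diff_le) auto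
  hence "?P n - ?F = 0"
    using sub card card_poly_roots_bound[of "?P n - ?F"]
      card_mono[OF poly_roots_finite[of "?P n - ?F"] sub] by fastforce
  thus ?thesis by simp
qed

text \<open>Compare the coefficients of x^n in the interpolation formula: P_n and all the products
  are monic of degree n.\<close>

lemma sum_reversed_weight:
  assumes a: "\<And>n. n \<ge> 1 \<Longrightarrow> a n > 0"
  shows "(\<Sum>x\<in>recurrence_roots a b (Suc n). reversed_weight a b n x) = 1"
proof -
  let ?S = "recurrence_roots a b (Suc n)"
  have card: "card ?S = Suc n"
    using card_recurrence_roots a by blast
  have "coeff (\<Prod>y\<in>?S - {x}. [:- y, 1:]) n = 1" if "x \<in> ?S" for x
    using lead_coeff_prod_linear[of "?S - {x}"] degree_prod_linear[of "?S - {x}"] that card by simp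
  hence "(\<Sum>x\<in>?S. reversed_weight a b n x) = coeff (recurrence_poly a b n) n"
    by (subst recurrence_poly_partial_fractions[OF a]) (auto simp: coeff_sum)
  thus ?thesis by simp
qed

lemma reversed_cf_partial_fractions:
  assumes a: "\<And>n. n \<ge> 1 \<Longrightarrow> a n > 0" and z: "Im z \<noteq> 0"
  shows "reversed_cf a b n z =
    (\<Sum>x\<in>recurrence_roots a b (Suc n). of_real (reversed_weight a b n x) / (z - of_real x))"
proof -
  let ?S = "recurrence_roots a b (Suc n)"
  let ?Q = "poly (cpoly (recurrence_poly a b (Suc n))) z"
  have nz: "?Q \<noteq> 0"
    using recurrence_poly_nonreal_nonzero[of a z] a z by simp
  have 1: "poly (\<Prod>y\<in>?S - {x}. [:- of_real y, 1:]) z / ?Q = 1 / (z - of_real x)" if "x \<in> ?S" for x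
  proof -
    have "?Q = (z - of_real x) * poly (\<Prod>y\<in>?S - {x}. [:- of_real y, 1:]) z"
      using that by (subst cpoly_recurrence_poly_decompose[OF a])
        (simp_all add: prod.remove[of ?S x] algebra_simps)
    thus ?thesis using nz by auto
  qed
  have "reversed_cf a b n z = poly (cpoly (recurrence_poly a b n)) z / ?Q"
    using reversed_cf_eq a z by blast
  also have "\<dots> = (\<Sum>x\<in>?S. of_real (reversed_weight a b n x) *
      (poly (\<Prod>y\<in>?S - {x}. [:- of_real y, 1:]) z / ?Q))"
    by (subst recurrence_poly_partial_fractions[OF a])
       (simp_all add: cpoly_sum cpoly_hom cpoly_prod poly_sum sum_divide_distrib)
  finally show ?thesis
    using 1 by simp
qed

section \<open>Measures with finite support\<close>

text \<open>The complement is the union of all open null sets, and by the Lindelof property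
  countably many of them have the same union.\<close>

lemma measure_support_compl_null:
  assumes "sets M = sets borel"
  shows "emeasure M (- measure_support M) = 0" and "open (- measure_support M)"
proof -
  define F where "F = {U. open U \<and> emeasure M U = 0}"
  have eq: "- measure_support M = \<Union>F"
    unfolding measure_support_def F_def by (fastforce simp: zero_less_iff_neq_zero)
  obtain F' where F': "F' \<subseteq> F" "countable F'" "\<Union>F' = \<Union>F"
    using Lindelof[of F] unfolding F_def by blast
  have "(\<Union>U\<in>F'. U) \<in> null_sets M"
    using F' assms by (intro null_sets_UN') (auto simp: F_def null_sets_def)
  thus "emeasure M (- measure_support M) = 0"
    using F' eq by (simp add: null_sets_def)
  show "open (- measure_support M)"
    unfolding eq F_def by blast
qed

lemma measure_eq_of_finite_support:
  assumes M: "finite_measure M" "sets M = sets borel" "finite (measure_support M)"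
    and N: "finite_measure N" "sets N = sets borel" "finite (measure_support N)"
    and atoms: "\<And>x. measure M {x} = measure N {x}"
  shows "M = N"
proof -
  \<comment> \<open>\<open>T\<close> may exceed the support, so that both measures can be summed
    over the union of their supports.\<close>
  have *: "emeasure K A = (\<Sum>x\<in>A \<inter> T. ennreal (measure K {x}))"
    if K: "finite_measure K" "sets K = sets borel" "finite T" "measure_support K \<subseteq> T"
      and A: "A \<in> sets borel" for K A T
  proof -
    have T: "T \<in> sets borel"
      using K(3) by (simp add: finite_imp_closed borel_closed)
    have "- measure_support K \<in> sets borel"
      using measure_support_compl_null(2)[OF K(2)] by (rule borel_open)
    hence "- measure_support K \<in> null_sets K"
      using measure_support_compl_null(1)[OF K(2)] K(2) by (simp add: null_sets_def)
    hence "A - T \<in> null_sets K"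
      by (rule null_sets_subset) (use A T K(2,4) in auto)
    hence "emeasure K ((A \<inter> T) \<union> (A - T)) = emeasure K (A \<inter> T)"
      by (intro emeasure_Un_null_set) (use A T K(2) in simp_all)
    hence "emeasure K A = emeasure K (A \<inter> T)"
      by (simp add: Un_Diff_Int Int_Diff_Un)
    also have "\<dots> = (\<Sum>x\<in>A \<inter> T. emeasure K {x})"
      using K(2,3) by (intro emeasure_eq_sum_singleton) simp_all
    finally show ?thesis
      using K(1) by (simp add: finite_measure.emeasure_eq_measure)
  qed
  show ?thesis
  proof (rule measure_eqI)
    fix A assume "A \<in> sets M"
    thus "emeasure M A = emeasure N A"
      using *[of M "measure_support M \<union> measure_support N" A]
        *[of N "measure_support M \<union> measure_support N" A] assms by simp
  qed (use assms in simp)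
qed

text \<open>Stieltjes inversion at a point: with e = 1 / (k + 1) the kernel i e / (y + i e - x) has
  modulus at most 1 and tends to the indicator of {y}, so dominated convergence applies.\<close>

lemma stieltjes_transform_atom:
  assumes "prob_on_reals M"
  shows "(\<lambda>k. \<i> / of_nat (Suc k) *
           (\<integral>x. 1 / ((of_real y + \<i> / of_nat (Suc k)) - of_real x) \<partial>M))
         \<longlonglongrightarrow> of_real (measure M {y})"
proof -
  interpret prob_space M using assms by (simp add: prob_on_reals_def)
  have [simp, measurable_cong]: "sets M = sets borel"
    using assms by (simp add: prob_on_reals_def)
  let ?s = "\<lambda>k x. (\<i> / of_nat (Suc k)) / ((of_real y + \<i> / of_nat (Suc k)) - of_real x)"
  have lim: "(\<lambda>k. ?s k x) \<longlonglongrightarrow> of_real (indicator {y} x)" for x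
  proof (cases "x = y")
    case False
    have "(\<lambda>k. \<i> / of_nat (Suc k)) \<longlonglongrightarrow> 0"
      using LIMSEQ_Suc[OF tendsto_divide_0[OF tendsto_const tendsto_of_nat]] by simp
    hence "(\<lambda>k. ?s k x) \<longlonglongrightarrow> 0 / ((of_real y + 0) - of_real x)"
      using False by (intro tendsto_intros) auto
    thus ?thesis using False by simp
  qed (simp del: of_nat_Suc)
  have bound: "cmod (?s k x) \<le> 1" for k x
  proof -
    have "cmod (\<i> / of_nat (Suc k)) = \<bar>Im ((of_real y + \<i> / of_nat (Suc k)) - of_real x)\<bar>"
      by (simp add: norm_divide Im_divide_of_nat del: of_nat_Suc)
    also have "\<dots> \<le> cmod ((of_real y + \<i> / of_nat (Suc k)) - of_real x)"
      by (rule abs_Im_le_cmod)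
    finally show ?thesis
      by (subst norm_divide) (simp add: divide_le_eq_1 del: of_nat_Suc)
  qed
  have "(\<lambda>k. \<integral>x. ?s k x \<partial>M) \<longlonglongrightarrow> (\<integral>x. of_real (indicator {y} x) \<partial>M)"
    by (rule integral_dominated_convergence[where w = "\<lambda>_. 1"]) (use lim bound in auto)
  also have "(\<integral>x. complex_of_real (indicator {y} x) \<partial>M) = of_real (measure M {y})"
    by simp
  finally show ?thesis
    by (subst integral_mult_right_zero[symmetric]) simp
qed

lemma stieltjes_transform_atoms_eq:
  assumes "prob_on_reals M" "prob_on_reals N"
    and "\<And>z. Im z \<noteq> 0 \<Longrightarrow>
      (\<integral>x. 1 / (z - complex_of_real x) \<partial>M) = (\<integral>x. 1 / (z - complex_of_real x) \<partial>N)"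
  shows "measure M {y} = measure N {y}"
proof -
  have nz: "Im (of_real y + \<i> / of_nat (Suc k)) \<noteq> 0" for k
    by (simp add: Im_divide_of_nat del: of_nat_Suc)
  have "(\<lambda>k. \<i> / of_nat (Suc k) *
           (\<integral>x. 1 / ((of_real y + \<i> / of_nat (Suc k)) - of_real x) \<partial>M))
         \<longlonglongrightarrow> of_real (measure N {y})"
    using stieltjes_transform_atom[OF assms(2), of y] by (simp only: assms(3)[OF nz])
  from LIMSEQ_unique[OF stieltjes_transform_atom[OF assms(1)] this]
  show ?thesis by simp
qed

text \<open>The push-forward replaces the power set of \<open>S\<close>, on which
  \<open>point_measure\<close> lives, by the Borel sets that \<open>prob_on_reals\<close>
  demands.\<close>

definition discrete_measure :: "real set \<Rightarrow> (real \<Rightarrow> real) \<Rightarrow> real measure" where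
  "discrete_measure S w = distr (point_measure S (\<lambda>x. ennreal (w x))) borel (\<lambda>x. x)"

context
  fixes S :: "real set" and w :: "real \<Rightarrow> real"
  assumes fin: "finite S" and pos: "\<And>x. x \<in> S \<Longrightarrow> w x > 0"
begin

lemma sets_discrete_measure [simp]: "sets (discrete_measure S w) = sets borel"
  by (simp add: discrete_measure_def)

lemma emeasure_discrete_measure:
  assumes "A \<in> sets borel"
  shows "emeasure (discrete_measure S w) A = (\<Sum>x\<in>A \<inter> S. ennreal (w x))"
  using assms fin unfolding discrete_measure_def
  by (subst emeasure_distr)
     (auto simp: measurable_def space_point_measure sets_point_measure emeasure_point_measure_finite)

lemma prob_on_reals_discrete_measure:
  assumes "sum w S = 1"
  shows "prob_on_reals (discrete_measure S w)"
  unfolding prob_on_reals_def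
proof (intro conjI prob_spaceI)
  have "space (discrete_measure S w) = UNIV"
    by (simp add: discrete_measure_def)
  thus "emeasure (discrete_measure S w) (space (discrete_measure S w)) = 1"
    using assms pos by (simp add: emeasure_discrete_measure sum_ennreal less_imp_le)
qed simp

lemma measure_discrete_measure_singleton:
  "measure (discrete_measure S w) {x} = (if x \<in> S then w x else 0)"
  using pos[of x] by (simp add: measure_def emeasure_discrete_measure)

lemma measure_support_discrete_measure: "measure_support (discrete_measure S w) = S"
proof (intro set_eqI iffI)
  fix x assume x: "x \<in> measure_support (discrete_measure S w)"
  have "open (- S)"
    using finite_imp_closed[OF fin] by (rule open_Compl)
  moreover have "emeasure (discrete_measure S w) (- S) = 0"
    using \<open>open (- S)\<close> by (subst emeasure_discrete_measure) auto
  ultimately show "x \<in> S"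
    using x by (force simp: measure_support_def)
next
  fix x assume x: "x \<in> S"
  have "emeasure (discrete_measure S w) U > 0" if U: "open U" "x \<in> U" for U
  proof -
    have "0 < ennreal (w x)"
      using pos[OF x] by simp
    also have "\<dots> \<le> (\<Sum>x\<in>U \<inter> S. ennreal (w x))"
      using fin x U by (intro member_le_sum) auto
    also have "\<dots> = emeasure (discrete_measure S w) U"
      using U by (subst emeasure_discrete_measure) simp_all
    finally show ?thesis .
  qed
  thus "x \<in> measure_support (discrete_measure S w)"
    by (simp add: measure_support_def)
qed

lemma integral_discrete_measure:
  fixes f :: "real \<Rightarrow> complex"
  assumes [measurable]: "f \<in> borel_measurable borel"
  shows "(\<integral>x. f x \<partial>discrete_measure S w) = (\<Sum>x\<in>S. w x *\<^sub>R f x)"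
proof -
  have "(\<integral>x. f x \<partial>discrete_measure S w) = (\<integral>x. f x \<partial>point_measure S (\<lambda>x. ennreal (w x)))"
    unfolding discrete_measure_def
    by (rule integral_distr)
       (simp_all add: assms measurable_def[of "point_measure _ _"] space_point_measure sets_point_measure)
  also have "\<dots> = (\<Sum>x\<in>S. w x *\<^sub>R f x)"
    using fin pos by (intro lebesgue_integral_point_measure_finite) (auto intro: less_imp_le)
  finally show ?thesis .
qed

end

section \<open>Orthogonal polynomials and reversed measures\<close>

text \<open>The moment functional, viewed as a linear form on polynomials.\<close>

definition poly_integral :: "real measure \<Rightarrow> real poly \<Rightarrow> real" where
  "poly_integral \<mu> p = (\<integral>x. poly p x \<partial>\<mu>)"

locale finite_moments =
  fixes \<mu> :: "real measure"
  assumes prob: "prob_on_reals \<mu>" and moments: "\<And>k. integrable \<mu> (\<lambda>x. x ^ k)"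
begin

abbreviation L where "L \<equiv> poly_integral \<mu>"

lemma sets_eq_borel [simp, measurable_cong]: "sets \<mu> = sets borel"
  using prob by (simp add: prob_on_reals_def)

lemma integrable_poly [simp]: "integrable \<mu> (poly p)"
proof -
  have "integrable \<mu> (\<lambda>x. \<Sum>i\<le>degree p. coeff p i * x ^ i)"
    by (intro Bochner_Integration.integrable_sum integrable_mult_right moments)
  thus ?thesis
    by (simp add: poly_altdef[abs_def])
qed

lemma L_add [simp]: "L (p + q) = L p + L q"
  and L_diff [simp]: "L (p - q) = L p - L q"
  and L_smult [simp]: "L (smult c p) = c * L p"
  and L_0 [simp]: "L 0 = 0"
  by (simp_all add: poly_integral_def)

lemma L_1 [simp]: "L 1 = 1"
  using prob by (simp add: poly_integral_def prob_on_reals_def prob_space.prob_space)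

lemma L_const [simp]: "L [:c:] = c"
  using L_smult[of c 1] by (simp del: L_smult)

lemma monic_orthogonal_polys_iff:
  "monic_orthogonal_polys \<mu> P \<longleftrightarrow>
     (\<forall>n. degree (P n) = n \<and> lead_coeff (P n) = 1) \<and> (\<forall>m n. m \<noteq> n \<longrightarrow> L (P m * P n) = 0)"
  by (simp add: monic_orthogonal_polys_def poly_integral_def)

text \<open>A monic polynomial of degree 0 is 1, so the recurrence leaves
  \<open>recurrence_poly a b\<close> as the only candidate for the existentially quantified
  family.\<close>

lemma recurrence_coeffs_iff:
  "recurrence_coeffs \<mu> a b \<longleftrightarrow> monic_orthogonal_polys \<mu> (recurrence_poly a b)"
proof
  assume "recurrence_coeffs \<mu> a b"
  then obtain P where P: "monic_orthogonal_polys \<mu> P"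
    "\<And>n. P (n + 1) = [:- b (n + 1), 1:] * P n - (if n = 0 then 0 else smult (a n) (P (n - 1)))"
    unfolding recurrence_coeffs_def by blast
  have "degree (P 0) = 0" "lead_coeff (P 0) = 1"
    using P(1) unfolding monic_orthogonal_polys_def by blast+
  hence "P 0 = 1"
    by (metis degree_0_id lead_coeff_pCons(2) monom_0 one_pCons degree_eq_zeroE pCons_0_0
        lead_coeff_pCons)
  hence "P = recurrence_poly a b"
    using P(2) by (rule recurrence_poly_unique)
  thus "monic_orthogonal_polys \<mu> (recurrence_poly a b)"
    using P(1) by simp
next
  assume *: "monic_orthogonal_polys \<mu> (recurrence_poly a b)"
  have "recurrence_poly a b (n + 1) = [:- b (n + 1), 1:] * recurrence_poly a b n
      - (if n = 0 then 0 else smult (a n) (recurrence_poly a b (n - 1)))" for n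
    by (cases n) (simp_all add: recurrence_poly.simps(3))
  with * show "recurrence_coeffs \<mu> a b"
    unfolding recurrence_coeffs_def by blast
qed

lemma monic_orthogonal_polys_lower_degree:
  assumes P: "monic_orthogonal_polys \<mu> P" and "degree q < n"
  shows "L (P n * q) = 0"
  using assms(2)
proof (induction "degree q" arbitrary: q rule: less_induct)
  case less
  let ?r = "q - smult (lead_coeff q) (P (degree q))"
  have deg: "degree (P k) = k" "coeff (P k) k = 1" for k
    using P unfolding monic_orthogonal_polys_iff by metis+
  have r: "L (P n * ?r) = 0"
  \<comment> \<open>Subtracting the leading multiple of P_{deg q} lowers the degree only if
    \<open>degree q\<close> is positive, because the zero polynomial also has degree 0; for
    constants the remainder is zero outright.\<close>
  proof (cases "degree q = 0")
    case True
    then obtain c where "q = [:c:]"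
      by (rule degree_eq_zeroE)
    moreover obtain d where "P 0 = [:d:]"
      using deg(1)[of 0] by (rule degree_eq_zeroE)
    ultimately have "?r = 0"
      using deg(2)[of 0] by simp
    thus ?thesis by simp
  next
    case False
    have "degree ?r \<le> degree q"
      using deg by (intro degree_diff_le order.trans[OF degree_smult_le]) auto
    moreover have "coeff ?r (degree q) = 0"
      using deg by simp
    ultimately have "degree ?r < degree q"
      using False by (metis leading_coeff_0_iff degree_0 order_le_less neq0_conv)
    thus ?thesis
      using less by simp
  qed
  have "P n * q = smult (lead_coeff q) (P n * P (degree q)) + P n * ?r"
    by (simp add: algebra_simps)
  moreover have "L (P n * P (degree q)) = 0"
    using P less.prems unfolding monic_orthogonal_polys_iff by auto
  ultimately show ?case
    using r by simp
qed

end

locale infinite_moments = finite_moments +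
  assumes infinite_support: "infinite (measure_support \<mu>)"
begin

text \<open>A vanishing integral makes the open set where p is nonzero a null set, which confines
  the support to the finitely many zeros of p.\<close>

lemma L_square_pos:
  assumes "p \<noteq> 0"
  shows "L (p * p) > 0"
proof (rule ccontr)
  assume "\<not> L (p * p) > 0"
  moreover have "L (p * p) \<ge> 0"
    unfolding poly_integral_def by (intro integral_nonneg_AE) auto
  ultimately have "integral\<^sup>L \<mu> (poly (p * p)) = 0"
    unfolding poly_integral_def by linarith
  hence "AE x in \<mu>. poly (p * p) x = 0"
    using integral_nonneg_eq_0_iff_AE[OF integrable_poly[of "p * p"]] by (simp del: poly_mult) simp
  hence ae: "AE x in \<mu>. x \<notin> {x. poly p x \<noteq> 0}"
    by auto
  have op: "open {x. poly p x \<noteq> 0}"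
    by (intro open_Collect_neq continuous_intros)
  hence "emeasure \<mu> {x. poly p x \<noteq> 0} = 0"
    using ae AE_iff_measurable[of "{x. poly p x \<noteq> 0}" \<mu> "\<lambda>x. poly p x = 0"]
      sets_eq_imp_space_eq[OF sets_eq_borel] by simp
  hence "measure_support \<mu> \<subseteq> {x. poly p x = 0}"
    using op by (fastforce simp: measure_support_def)
  thus False
    using infinite_support poly_roots_finite[OF assms] finite_subset by blast
qed

text \<open>P_n - Q_n has degree below n, hence is orthogonal to P_n and to Q_n, and so to
  itself.\<close>

lemma monic_orthogonal_polys_unique:
  assumes P: "monic_orthogonal_polys \<mu> P" and Q: "monic_orthogonal_polys \<mu> Q"
  shows "P = Q"
proof
  fix n
  let ?q = "P n - Q n"
  have deg: "degree (P n) = n" "coeff (P n) n = 1" "degree (Q n) = n" "coeff (Q n) n = 1"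
    using P Q unfolding monic_orthogonal_polys_iff by metis+
  show "P n = Q n"
  proof (rule ccontr)
    assume ne: "P n \<noteq> Q n"
    have "degree ?q \<le> n"
      using deg by (intro degree_diff_le) auto
    moreover have "coeff ?q n = 0"
      using deg by simp
    ultimately have "degree ?q < n"
      using ne by (metis leading_coeff_0_iff order_le_less right_minus_eq)
    hence "L (P n * ?q - Q n * ?q) = 0"
      using monic_orthogonal_polys_lower_degree P Q by (simp only: L_diff)
    hence "L (?q * ?q) = 0"
      by (simp only: left_diff_distrib)
    thus False
      using L_square_pos[of ?q] ne by simp
  qed
qed

text \<open>a_n = L(P_n^2) / L(P_{n-1}^2): expand L(P_n x P_{n-1}) once through the lower degree of
  x P_{n-1} - P_n and once through the recurrence for x P_n.\<close>

lemma recurrence_coeffs_pos: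
  assumes "recurrence_coeffs \<mu> a b" and "n \<ge> 1"
  shows "a n > 0"
proof -
  let ?P = "recurrence_poly a b" and ?x = "[:0, 1:] :: real poly"
  obtain k where k: "n = Suc k"
    using assms(2) by (cases n) auto
  have P: "monic_orthogonal_polys \<mu> ?P"
    using assms(1) by (simp add: recurrence_coeffs_iff)
  have 0: "L (?P i * ?P j) = 0" if "i \<noteq> j" for i j
    using P that unfolding monic_orthogonal_polys_iff by blast
  have "degree (?x * ?P k - ?P (Suc k)) \<le> Suc k"
    by (intro degree_diff_le order.trans[OF degree_mult_le]) auto
  moreover have "coeff (?x * ?P k - ?P (Suc k)) (Suc k) = 0"
    by simp
  ultimately have "degree (?x * ?P k - ?P (Suc k)) < Suc k"
    by (metis degree_0 leading_coeff_0_iff order_le_less zero_less_Suc)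
  hence "L (?P (Suc k) * (?x * ?P k - ?P (Suc k))) = 0"
    by (rule monic_orthogonal_polys_lower_degree[OF P])
  moreover have "?P (Suc k) * (?x * ?P k - ?P (Suc k)) =
     ?P (Suc (Suc k)) * ?P k + smult (b (k + 2)) (?P (Suc k) * ?P k)
     + smult (a n) (?P k * ?P k) - ?P (Suc k) * ?P (Suc k)"
    by (simp add: k recurrence_poly.simps(3) algebra_simps smult_diff_right)
  ultimately have "a n * L (?P k * ?P k) = L (?P (Suc k) * ?P (Suc k))"
    using 0 by (simp del: recurrence_poly.simps)
  thus ?thesis
    using L_square_pos[of "?P k"] L_square_pos[of "?P (Suc k)"]
    by (metis recurrence_poly_neq_0 zero_less_mult_pos2)
qed

text \<open>The Stieltjes procedure: the two quotients are what orthogonality of P_{n+2} to P_{n+1}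
  and to P_n dictates.\<close>

fun orthopoly :: "nat \<Rightarrow> real poly" where
  "orthopoly 0 = 1"
| "orthopoly (Suc 0) = [:- L [:0, 1:], 1:]"
| "orthopoly (Suc (Suc n)) =
     [:- (L ([:0, 1:] * (orthopoly (Suc n) * orthopoly (Suc n)))
            / L (orthopoly (Suc n) * orthopoly (Suc n))), 1:] * orthopoly (Suc n)
     - smult (L (orthopoly (Suc n) * orthopoly (Suc n)) / L (orthopoly n * orthopoly n))
         (orthopoly n)"

lemma recurrence_coeffs_exist: "\<exists>a b. recurrence_coeffs \<mu> a b"
proof -
  let ?P = orthopoly and ?x = "[:0, 1:] :: real poly"
  define a where "a n = L (?P n * ?P n) / L (?P (n - 1) * ?P (n - 1))" for n
  define b where "b n = L (?x * (?P (n - 1) * ?P (n - 1))) / L (?P (n - 1) * ?P (n - 1))" for n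
  have eq: "?P = recurrence_poly a b"
  proof (rule recurrence_poly_unique)
    fix n
    show "?P (n + 1) = [:- b (n + 1), 1:] * ?P n - (if n = 0 then 0 else smult (a n) (?P (n - 1)))"
      by (cases n) (simp_all add: a_def b_def)
  qed simp
  have nz: "L (?P n * ?P n) > 0" for n
    by (rule L_square_pos) (simp add: eq)
  have rec: "?P (Suc (Suc n)) = ?x * ?P (Suc n) - smult (b (n + 2)) (?P (Suc n)) - smult (a (n + 1)) (?P n)" for n
    unfolding eq by (simp add: recurrence_poly.simps(3) algebra_simps)
  \<comment> \<open>The recurrence solved for x P_i; the disjunction records that the P_{i-1} term
    is missing for i = 0.\<close>
  have x_mult: "\<exists>q. ?x * ?P i = ?P (Suc i) + smult (b (i + 1)) (?P i) + q \<and>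
      (i = 0 \<and> q = 0 \<or> (\<exists>j. i = Suc j \<and> q = smult (a i) (?P j)))" for i
  proof (cases i)
    case 0
    thus ?thesis unfolding eq by simp
  next
    case (Suc j)
    thus ?thesis using rec[of j] by (auto simp: algebra_simps simp del: orthopoly.simps)
  qed
  have orth: "\<forall>i j. i < j \<longrightarrow> j \<le> n \<longrightarrow> L (?P i * ?P j) = 0" for n
  proof (induction n)
    case (Suc n)
    have "L (?P i * ?P (Suc n)) = 0" if i: "i < Suc n" for i
    proof (cases n)
      case 0
      thus ?thesis
        using i L_diff[of "[:0, 1:]" "[:L [:0, 1:]:]"] by (simp del: L_diff)
    next
      case n: (Suc k)
      have IH: "L (?P u * ?P v) = 0" if "u \<noteq> v" "u \<le> Suc k" "v \<le> Suc k" for u v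
        using Suc n that by (metis mult.commute nat_neq_iff)
      have "?P i * ?P (Suc (Suc k)) = (?x * ?P i) * ?P (Suc k) - smult (b (k + 2)) (?P i * ?P (Suc k))
          - smult (a (k + 1)) (?P i * ?P k)"
        unfolding rec by (simp add: algebra_simps del: orthopoly.simps)
      hence *: "L (?P i * ?P (Suc n)) = L ((?x * ?P i) * ?P (Suc k)) - b (k + 2) * L (?P i * ?P (Suc k))
          - a (k + 1) * L (?P i * ?P k)"
        by (simp add: n del: orthopoly.simps mult_pCons_left)
      have **: "L ((?x * ?P i) * ?P (Suc k)) = L (?P (Suc i) * ?P (Suc k))" if "i \<le> k"
      proof -
        obtain q where q: "?x * ?P i = ?P (Suc i) + smult (b (i + 1)) (?P i) + q"
          "i = 0 \<and> q = 0 \<or> (\<exists>j. i = Suc j \<and> q = smult (a i) (?P j))"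
          using x_mult[of i] by blast
        have "L (q * ?P (Suc k)) = 0"
          using q(2) IH[of "i - 1" "Suc k"] that by (auto simp del: orthopoly.simps)
        thus ?thesis
          using IH[of i "Suc k"] that by (simp add: q(1) distrib_right del: orthopoly.simps mult_pCons_left)
      qed
      \<comment> \<open>The choice of b settles i = k + 1 and the choice of a settles i = k. For i <
        k the factor x moves over to P_i, which only reaches P_{i+1}, still below P_{k+1}.\<close>
      consider "i = Suc k" | "i = k" | "i < k"
        using i n by linarith
      thus ?thesis
      proof cases
        case 1
        have "b (k + 2) * L (?P (Suc k) * ?P (Suc k)) = L (?x * (?P (Suc k) * ?P (Suc k)))"
          using nz[of "Suc k"] by (simp add: b_def del: orthopoly.simps mult_pCons_left)
        thus ?thesis
          using * 1 IH[of "Suc k" k] by (simp add: mult.assoc del: orthopoly.simps mult_pCons_left)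
      next
        case 2
        have "a (k + 1) * L (?P k * ?P k) = L (?P (Suc k) * ?P (Suc k))"
          using nz[of k] by (simp add: a_def del: orthopoly.simps mult_pCons_left)
        thus ?thesis
          using * 2 ** IH[of k "Suc k"] by (simp del: orthopoly.simps mult_pCons_left)
      next
        case 3
        thus ?thesis
          using * ** IH[of i "Suc k"] IH[of i k] IH[of "Suc i" "Suc k"]
          by (simp del: orthopoly.simps mult_pCons_left)
      qed
    qed
    with Suc show ?case
      by (metis le_Suc_eq)
  qed simp
  have "monic_orthogonal_polys \<mu> (recurrence_poly a b)"
    unfolding monic_orthogonal_polys_iff eq[symmetric]
    using orth by (metis eq recurrence_poly_monic mult.commute nat_neq_iff order_refl)
  thus ?thesis
    using recurrence_coeffs_iff by blast
qed

text \<open>Partial fractions show that the discrete measure qualifies; any other candidate has the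
  same transform, hence the same atoms, and finite support.\<close>

lemma reversed_measure_eq:
  assumes ab: "recurrence_coeffs \<mu> a b"
  shows "reversed_measure \<mu> n =
    discrete_measure (recurrence_roots a b (Suc n)) (reversed_weight a b n)" (is "_ = ?\<nu>")
proof -
  have a: "a n > 0" if "n \<ge> 1" for n
    using recurrence_coeffs_pos[OF ab that] .
  have fin: "finite (recurrence_roots a b (Suc n))"
    by simp
  have pos: "reversed_weight a b n x > 0" if "x \<in> recurrence_roots a b (Suc n)" for x
    using reversed_weight_pos a that by blast
  note disc = fin pos
  have prob\<nu>: "prob_on_reals ?\<nu>"
    by (rule prob_on_reals_discrete_measure) (use disc sum_reversed_weight[OF a] in auto)
  have supp\<nu>: "measure_support ?\<nu> = recurrence_roots a b (Suc n)"
    by (rule measure_support_discrete_measure) (use disc in auto)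
  have trans\<nu>: "(\<integral>x. 1 / (z - complex_of_real x) \<partial>?\<nu>) = reversed_cf a b n z" if "Im z \<noteq> 0" for z
  proof -
    have "(\<integral>x. 1 / (z - complex_of_real x) \<partial>?\<nu>)
        = (\<Sum>x\<in>recurrence_roots a b (Suc n). reversed_weight a b n x *\<^sub>R (1 / (z - complex_of_real x)))"
      by (rule integral_discrete_measure) (use disc in auto)
    also have "\<dots> = reversed_cf a b n z"
      using reversed_cf_partial_fractions[OF a that] by (simp add: scaleR_conv_of_real)
    finally show ?thesis .
  qed
  have "is_reversed_measure \<mu> n ?\<nu>"
    unfolding is_reversed_measure_def supp\<nu>
    using ab prob\<nu> trans\<nu> card_recurrence_roots[OF a] by auto
  moreover have "\<nu> = ?\<nu>" if \<nu>: "is_reversed_measure \<mu> n \<nu>" for \<nu>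
  proof -
    from \<nu> obtain a' b' where prob': "prob_on_reals \<nu>" and card': "card (measure_support \<nu>) = n + 1"
      and ab': "recurrence_coeffs \<mu> a' b'"
      and trans': "\<And>z. Im z \<noteq> 0 \<Longrightarrow> (\<integral>x. 1 / (z - complex_of_real x) \<partial>\<nu>) = reversed_cf a' b' n z"
      unfolding is_reversed_measure_def by blast
    have a': "a' n > 0" if "n \<ge> 1" for n
      using recurrence_coeffs_pos[OF ab' that] .
    \<comment> \<open>The two coefficient pairs may differ at the unconstrained index 0, so the
      fractions are compared through the unique orthogonal polynomials.\<close>
    have "recurrence_poly a' b' = recurrence_poly a b"
      using ab ab' recurrence_coeffs_iff monic_orthogonal_polys_unique by blast
    hence "reversed_cf a' b' n z = reversed_cf a b n z" if "Im z \<noteq> 0" for z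
      using reversed_cf_eq[OF a that] reversed_cf_eq[OF a' that] by simp
    hence "measure \<nu> {x} = measure ?\<nu> {x}" for x
      using trans' trans\<nu> by (intro stieltjes_transform_atoms_eq prob' prob\<nu>) simp
    moreover have "finite (measure_support \<nu>)"
      using card' card.infinite by fastforce
    ultimately show ?thesis
      using prob' prob\<nu> supp\<nu> fin
      by (intro measure_eq_of_finite_support)
         (simp_all add: prob_on_reals_def prob_space.finite_measure)
  qed
  ultimately show ?thesis
    unfolding reversed_measure_def by (rule the_equality)
qed

lemma measure_support_reversed_measure:
  assumes "recurrence_coeffs \<mu> a b"
  shows "measure_support (reversed_measure \<mu> n) = recurrence_roots a b (Suc n)"
  unfolding reversed_measure_eq[OF assms]
  by (rule measure_support_discrete_measure)
     (use reversed_weight_pos recurrence_coeffs_pos[OF assms] in auto)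

lemma measure_reversed_measure_singleton:
  assumes "recurrence_coeffs \<mu> a b" and "x \<in> recurrence_roots a b (Suc n)"
  shows "measure (reversed_measure \<mu> n) {x} = reversed_weight a b n x"
  unfolding reversed_measure_eq[OF assms(1)]
  by (subst measure_discrete_measure_singleton)
     (use assms reversed_weight_pos recurrence_coeffs_pos[OF assms(1)] in auto)

end

section \<open>Recurrence coefficients of generalized Hermite type\<close>

text \<open>For the weight |c (x - d)|^gamma exp(-c^2 (x - d)^2) the scale is s = 1 / (2 c^2); gamma
  = 0 gives the classical Hermite pattern a_n = n s.\<close>

definition hermite_coeffs :: "real \<Rightarrow> real \<Rightarrow> real \<Rightarrow> (nat \<Rightarrow> real) \<Rightarrow> (nat \<Rightarrow> real) \<Rightarrow> bool" where
  "hermite_coeffs \<gamma> s d a b \<longleftrightarrow>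
     (\<forall>n\<ge>1. b n = d) \<and>
     (\<forall>k. a (2 * k + 1) = (2 * real k + 1 + \<gamma>) * s) \<and> (\<forall>k. a (2 * k + 2) = (2 * real k + 2) * s)"

lemma hermite_coeffs_pos:
  assumes "hermite_coeffs \<gamma> s d a b" "\<gamma> > -1" "s > 0" "n \<ge> 1"
  shows "a n > 0"
proof (cases "odd n")
  case True
  then obtain k where "n = 2 * k + 1" by (rule oddE)
  moreover have "2 * real k + 1 + \<gamma> > 0" using assms(2) by linarith
  ultimately show ?thesis using assms by (simp add: hermite_coeffs_def)
next
  case False
  then obtain j where "n = 2 * j" by auto
  then obtain k where "n = 2 * k + 2" using assms(4) by (cases j) auto
  thus ?thesis using assms by (simp add: hermite_coeffs_def)
qed

lemma hermite_coeffs_rec: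
  assumes "hermite_coeffs \<gamma> s d a b"
  shows "poly (recurrence_poly a b (2 * k + 2)) x =
      (x - d) * poly (recurrence_poly a b (2 * k + 1)) x
      - (2 * real k + 1 + \<gamma>) * s * poly (recurrence_poly a b (2 * k)) x"
    and "poly (recurrence_poly a b (2 * k + 3)) x =
      (x - d) * poly (recurrence_poly a b (2 * k + 2)) x
      - (2 * real k + 2) * s * poly (recurrence_poly a b (2 * k + 1)) x"
proof -
  have b: "b (2 * k + 2) = d" "b (2 * k + 3) = d"
    and a: "a (2 * k + 1) = (2 * real k + 1 + \<gamma>) * s" "a (2 * k + 2) = (2 * real k + 2) * s"
    using assms by (simp_all add: hermite_coeffs_def)
  show "poly (recurrence_poly a b (2 * k + 2)) x =
      (x - d) * poly (recurrence_poly a b (2 * k + 1)) x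
      - (2 * real k + 1 + \<gamma>) * s * poly (recurrence_poly a b (2 * k)) x"
    unfolding b(1)[symmetric] a(1)[symmetric] by (rule poly_recurrence_poly_rec) simp_all
  show "poly (recurrence_poly a b (2 * k + 3)) x =
      (x - d) * poly (recurrence_poly a b (2 * k + 2)) x
      - (2 * real k + 2) * s * poly (recurrence_poly a b (2 * k + 1)) x"
    unfolding b(2)[symmetric] a(2)[symmetric] by (rule poly_recurrence_poly_rec) simp_all
qed

text \<open>The identities are proved in one induction: each follows by differentiating the
  recurrence and inserting both identities of the preceding step or its odd half. Keeping the factor
  x - d avoids dividing P_{2k+1} by its zero d.\<close>

lemma hermite_coeffs_pderiv:
  assumes H: "hermite_coeffs \<gamma> s d a b"
  shows "poly (pderiv (recurrence_poly a b (2 * k + 2))) x =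
      (2 * real k + 2) * poly (recurrence_poly a b (2 * k + 1)) x"
    and "(x - d) * poly (pderiv (recurrence_poly a b (2 * k + 1))) x =
      (2 * real k + 1 + \<gamma>) * (x - d) * poly (recurrence_poly a b (2 * k)) x
      - \<gamma> * poly (recurrence_poly a b (2 * k + 1)) x"
proof -
  let ?p = "\<lambda>n. poly (recurrence_poly a b n) x"
  let ?q = "\<lambda>n. poly (pderiv (recurrence_poly a b n)) x"
  have q: "?q (2 * k + 2) = ?p (2 * k + 1) + (x - d) * ?q (2 * k + 1)
             - (2 * real k + 1 + \<gamma>) * s * ?q (2 * k)"
    "?q (2 * k + 3) = ?p (2 * k + 2) + (x - d) * ?q (2 * k + 2)
             - (2 * real k + 2) * s * ?q (2 * k + 1)" for k
  proof -
    have b: "b (2 * k + 2) = d" "b (2 * k + 3) = d"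
      and a: "a (2 * k + 1) = (2 * real k + 1 + \<gamma>) * s" "a (2 * k + 2) = (2 * real k + 2) * s"
      using H by (simp_all add: hermite_coeffs_def)
    show "?q (2 * k + 2) = ?p (2 * k + 1) + (x - d) * ?q (2 * k + 1)
             - (2 * real k + 1 + \<gamma>) * s * ?q (2 * k)"
      unfolding b(1)[symmetric] a(1)[symmetric] by (rule poly_pderiv_recurrence_poly_rec) simp_all
    show "?q (2 * k + 3) = ?p (2 * k + 2) + (x - d) * ?q (2 * k + 2)
             - (2 * real k + 2) * s * ?q (2 * k + 1)"
      unfolding b(2)[symmetric] a(2)[symmetric] by (rule poly_pderiv_recurrence_poly_rec) simp_all
  qed
  note p = hermite_coeffs_rec[OF H, of _ x]
  have "?q (2 * k + 2) = (2 * real k + 2) * ?p (2 * k + 1) \<and>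
    (x - d) * ?q (2 * k + 1) = (2 * real k + 1 + \<gamma>) * (x - d) * ?p (2 * k) - \<gamma> * ?p (2 * k + 1)"
  proof (induction k)
    case 0
    have "?p 1 = x - d" "?q 1 = 1" "?q 0 = 0" "?p 0 = 1"
      using H by (simp_all add: hermite_coeffs_def pderiv_pCons)
    thus ?case
      using q(1)[of 0] by (simp del: recurrence_poly.simps) (simp add: algebra_simps)
  next
    case (Suc k)
    have O: "(x - d) * ?q (2 * k + 3) =
        (2 * real k + 3 + \<gamma>) * (x - d) * ?p (2 * k + 2) - \<gamma> * ?p (2 * k + 3)"
      using Suc.IH p(1)[of k] p(2)[of k] q(2)[of k] by algebra
    have "?q (2 * k + 4) = ?p (2 * k + 3) + (x - d) * ?q (2 * k + 3)
             - (2 * real k + 3 + \<gamma>) * s * ?q (2 * k + 2)"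
      using q(1)[of "Suc k"] by (simp add: algebra_simps numeral_eq_Suc)
    hence "?q (2 * k + 4) = (2 * real k + 4) * ?p (2 * k + 3)"
      using O Suc.IH p(2)[of k] by algebra
    thus ?case
      using O by (simp add: numeral_eq_Suc algebra_simps)
  qed
  thus "?q (2 * k + 2) = (2 * real k + 2) * ?p (2 * k + 1)"
    "(x - d) * ?q (2 * k + 1) = (2 * real k + 1 + \<gamma>) * (x - d) * ?p (2 * k) - \<gamma> * ?p (2 * k + 1)"
    by blast+
qed

lemma hermite_coeffs_root:
  assumes "hermite_coeffs \<gamma> s d a b"
  shows "d \<in> recurrence_roots a b (2 * k + 1)"
proof (induction k)
  case 0
  thus ?case using assms by (simp add: recurrence_roots_def hermite_coeffs_def)
next
  case (Suc k)
  thus ?case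
    using hermite_coeffs_rec(2)[OF assms, of k d] by (simp add: recurrence_roots_def numeral_3_eq_3)
qed

lemma hermite_coeffs_weights:
  assumes H: "hermite_coeffs \<gamma> s d a b" and \<gamma>: "\<gamma> > -1" and s: "s > 0"
  shows "x \<in> recurrence_roots a b (2 * k + 2) \<Longrightarrow> reversed_weight a b (2 * k + 1) x = 1 / (2 * real k + 2)"
    and "x \<in> recurrence_roots a b (2 * k + 1) \<Longrightarrow> x \<noteq> d \<Longrightarrow>
           reversed_weight a b (2 * k) x = 1 / (2 * real k + 1 + \<gamma>)"
    and "reversed_weight a b (2 * k) d = (1 + \<gamma>) / (2 * real k + 1 + \<gamma>)"
proof -
  note a = hermite_coeffs_pos[OF H \<gamma> s]
  have c: "2 * real k + 1 + \<gamma> > 0"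
    using \<gamma> by linarith
  let ?p = "\<lambda>n. poly (recurrence_poly a b n)"
  let ?q = "\<lambda>n. poly (pderiv (recurrence_poly a b n))"
  {
    assume x: "x \<in> recurrence_roots a b (2 * k + 2)"
    hence "?p (2 * k + 1) x \<noteq> 0"
      using recurrence_poly_consecutive_nonzero[of a b "2 * k + 1" x] a
      by (simp add: recurrence_roots_def)
    thus "reversed_weight a b (2 * k + 1) x = 1 / (2 * real k + 2)"
      using hermite_coeffs_pderiv(1)[OF H, of k x] by (simp add: reversed_weight_def)
  next
    have *: "reversed_weight a b (2 * k) x = 1 / (2 * real k + 1 + \<gamma>)"
      if x: "x \<in> recurrence_roots a b (2 * k + 1)" "x \<noteq> d" for x
    proof -
      have "?p (2 * k) x \<noteq> 0"
        using recurrence_poly_consecutive_nonzero[of a b "2 * k" x] a x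
        by (simp add: recurrence_roots_def)
      moreover have "(x - d) * ?q (2 * k + 1) x = (x - d) * ((2 * real k + 1 + \<gamma>) * ?p (2 * k) x)"
        using hermite_coeffs_pderiv(2)[OF H, where k = k and x = x] x by (simp add: recurrence_roots_def algebra_simps)
      hence "?q (2 * k + 1) x = (2 * real k + 1 + \<gamma>) * ?p (2 * k) x"
        using x(2) by simp
      ultimately show ?thesis
        by (simp add: reversed_weight_def)
    qed
    thus "x \<in> recurrence_roots a b (2 * k + 1) \<Longrightarrow> x \<noteq> d \<Longrightarrow>
           reversed_weight a b (2 * k) x = 1 / (2 * real k + 1 + \<gamma>)" .
    let ?S = "recurrence_roots a b (2 * k + 1)"
    have d: "d \<in> ?S"
      by (rule hermite_coeffs_root[OF H])
    have card: "card ?S = 2 * k + 1"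
      by (rule card_recurrence_roots) (use a in auto)
    \<comment> \<open>At d the odd-degree identity reads 0 = 0, so this mass is found as what the 2k
      equal masses leave over from total mass 1.\<close>
    have "1 = (\<Sum>x\<in>?S. reversed_weight a b (2 * k) x)"
      using sum_reversed_weight[of a b "2 * k"] a by simp
    also have "\<dots> = reversed_weight a b (2 * k) d + (\<Sum>x\<in>?S - {d}. reversed_weight a b (2 * k) x)"
      using d by (simp add: sum.remove)
    also have "(\<Sum>x\<in>?S - {d}. reversed_weight a b (2 * k) x) = (\<Sum>x\<in>?S - {d}. 1 / (2 * real k + 1 + \<gamma>))"
      by (rule sum.cong) (use * in auto)
    also have "\<dots> = 2 * real k / (2 * real k + 1 + \<gamma>)"
      using card d by simp
    finally show "reversed_weight a b (2 * k) d = (1 + \<gamma>) / (2 * real k + 1 + \<gamma>)"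
      using c by (simp add: field_simps)
  }
qed

text \<open>Total mass 1 forces w = 1 / (n + 1). Then both sides agree at the n + 1 zeros of P_{n+1}
  and have degree at most n.\<close>

lemma pderiv_eq_of_equal_weights:
  assumes a: "\<And>n. n \<ge> 1 \<Longrightarrow> a n > 0"
    and w: "\<And>x. x \<in> recurrence_roots a b (Suc n) \<Longrightarrow> reversed_weight a b n x = w"
  shows "pderiv (recurrence_poly a b (Suc n)) = smult (real (Suc n)) (recurrence_poly a b n)"
proof -
  let ?S = "recurrence_roots a b (Suc n)" and ?P = "recurrence_poly a b"
  let ?D = "pderiv (?P (Suc n)) - smult (real (Suc n)) (?P n)"
  have card: "card ?S = Suc n"
    using card_recurrence_roots a by blast
  have "1 = (\<Sum>x\<in>?S. w)"
    using sum_reversed_weight[of a b n] a w by simp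
  hence w_eq: "real (Suc n) * w = 1"
    using card by simp
  have "poly ?D x = 0" if x: "x \<in> ?S" for x
  proof -
    have "poly (pderiv (?P (Suc n))) x \<noteq> 0"
      using pderiv_recurrence_poly_root_nonzero[of a b "Suc n" x] a x by (simp add: recurrence_roots_def)
    hence "poly (?P n) x = w * poly (pderiv (?P (Suc n))) x"
      using w[OF x] by (simp add: reversed_weight_def divide_simps)
    hence "real (Suc n) * poly (?P n) x = poly (pderiv (?P (Suc n))) x"
      using w_eq by (simp only: mult.assoc[symmetric])
    thus ?thesis
      by simp
  qed
  hence sub: "?S \<subseteq> {x. poly ?D x = 0}"
    by blast
  have "degree ?D \<le> n"
    by (intro degree_diff_le order.trans[OF degree_smult_le]) (auto simp: degree_pderiv)
  hence "?D = 0"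
    using sub card card_poly_roots_bound[of ?D] card_mono[OF poly_roots_finite[of ?D] sub] by fastforce
  thus ?thesis
    by simp
qed

lemma coeff_linear_mult: "coeff ([:c, 1:] * p) (Suc n) = c * coeff p (Suc n) + coeff p n"
  for p :: "real poly"
  by simp

text \<open>For even \<open>n\<close> only the support point \<open>d\<close> is used, as a common zero of the polynomials of odd
  degree: consecutive polynomials have no common zero, which forces \<open>b n = d\<close> for \<open>n \<ge> 5\<close>.
  The coefficients of smaller index then follow from the top coefficient of one more identity.\<close>

lemma hermite_coeffs_of_pderiv_and_root:
  fixes a b :: "nat \<Rightarrow> real"
  assumes a: "\<And>n. n \<ge> 1 \<Longrightarrow> a n > 0"
    and deriv: "\<And>k. pderiv (recurrence_poly a b (2 * k + 2)) =
                  smult (2 * real k + 2) (recurrence_poly a b (2 * k + 1))"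
    and root: "\<And>k. poly (recurrence_poly a b (2 * k + 3)) d = 0"
  shows "\<exists>\<gamma> s. \<gamma> > -1 \<and> s > 0 \<and> hermite_coeffs \<gamma> s d a b"
proof -
  define p where "p n = poly (recurrence_poly a b n)" for n
  define q where "q n = poly (pderiv (recurrence_poly a b n))" for n
  have p01: "p 0 x = 1" "p 1 x = x - b 1" and q01: "q 0 x = 0" "q 1 x = 1" for x
    by (simp_all add: p_def q_def pderiv_pCons)
  have p: "p l x = (x - b l) * p m x - a m * p n x"
    and q: "q l x = p m x + (x - b l) * q m x - a m * q n x" if "m = Suc n" "l = Suc m" for l m n x
    unfolding p_def q_def
    using that by (intro poly_recurrence_poly_rec poly_pderiv_recurrence_poly_rec; simp)+
  have q_even: "q l x = (2 * real k + 2) * p m x" if "l = 2 * k + 2" "m = 2 * k + 1" for k l m x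
    unfolding p_def q_def that deriv by simp
  have p_root: "p l d = 0" if "l = 2 * k + 3" for k l
    unfolding that p_def by (rule root)
  have q_nz: "q n x \<noteq> 0" if "p n x = 0" for n x
    using pderiv_recurrence_poly_root_nonzero[of a b n x] a that by (simp add: p_def q_def)
  have p_nz: "p n x \<noteq> 0" if "p m x = 0" "m = Suc n" for m n x
    using recurrence_poly_consecutive_nonzero[of a b n x] a that by (simp add: p_def)
  \<comment> \<open>Two expressions for P_{2k+4}' are equated: the assumed multiple of P_{2k+3} and
    the differentiated recurrence.\<close>
  have A: "(x - b (2 * k + 4)) * q (2 * k + 3) x =
      (2 * real k + 3) * p (2 * k + 3) x + (2 * real k + 2) * a (2 * k + 3) * p (2 * k + 1) x" for k x
  proof -
    have "q (2 * k + 4) x = (2 * real k + 4) * p (2 * k + 3) x"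
      using q_even[of "2 * k + 4" "k + 1" "2 * k + 3" x] by (simp add: algebra_simps)
    moreover have "q (2 * k + 4) x
        = p (2 * k + 3) x + (x - b (2 * k + 4)) * q (2 * k + 3) x - a (2 * k + 3) * q (2 * k + 2) x"
      by (rule q) simp_all
    moreover have "q (2 * k + 2) x = (2 * real k + 2) * p (2 * k + 1) x"
      by (rule q_even) simp_all
    ultimately show ?thesis
      by algebra
  qed
  have b_ge5: "b (2 * k + 5) = d" "b (2 * k + 6) = d" for k
  proof -
    have r: "p (2 * k + 5) d = 0" "p (2 * k + 3) d = 0"
      using p_root[of "2 * k + 3" k] p_root[of "2 * k + 5" "k + 1"] by simp_all
    have "p (2 * k + 4) d \<noteq> 0"
      using r(1) by (rule p_nz) simp
    moreover have "p (2 * k + 5) d = (d - b (2 * k + 5)) * p (2 * k + 4) d - a (2 * k + 4) * p (2 * k + 3) d"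
      by (rule p) simp_all
    ultimately show "b (2 * k + 5) = d"
      using r by simp
    have i: "2 * (k + 1) + 4 = 2 * k + 6" "2 * (k + 1) + 3 = 2 * k + 5" "2 * (k + 1) + 1 = 2 * k + 3"
      by simp_all
    \<comment> \<open>At d the right side of \<open>A\<close> vanishes, being a combination of two
      odd-degree polynomials, while simplicity of the zero keeps P_{2k+5}'(d) nonzero.\<close>
    have "(d - b (2 * k + 6)) * q (2 * k + 5) d = 0"
      using A[where k = "k + 1" and x = d] r unfolding i by simp
    thus "b (2 * k + 6) = d"
      using q_nz[OF r(1)] by simp
  qed
  have q2: "q 2 x = (2 * real 0 + 2) * p 1 x"
    and q4: "q 4 x = (2 * real 1 + 2) * p 3 x" for x
    by (rule q_even; simp)+
  have p3_root: "p 3 d = 0"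
    by (rule p_root[of _ 0]) simp
  have b4: "b 4 = d"
  proof -
    let ?P = "recurrence_poly a b" and ?y = "[:- d, 1:]"
    \<comment> \<open>\<open>A\<close> for k = 1, reduced through the recurrences to P_3, P_2 and
      P_3'. Only the first term reaches degree 4, so the coefficient of x^4 isolates b_4 -
      d.\<close>
    have id: "4 * (b 4 - d) * ((x - d) * p 3 x) + 4 * a 3 * ((x - d) * p 2 x) - a 4 * ((x - d) * q 3 x)
        = (4 * a 5 - 5 * a 4) * p 3 x" for x
    proof -
      have b: "b 5 = d" "b 6 = d"
        using b_ge5[of 0] by simp_all
      have "(x - b 6) * q 5 x = 5 * p 5 x + 4 * a 5 * p 3 x"
        using A[where k = 1 and x = x] by simp
      moreover have "q 5 x = p 4 x + (x - b 5) * q 4 x - a 4 * q 3 x"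
        by (rule q) simp_all
      moreover have "p 5 x = (x - b 5) * p 4 x - a 4 * p 3 x"
        by (rule p) simp_all
      moreover have "q 4 x = 4 * p 3 x"
        using q4[of x] by simp
      moreover have "p 4 x = (x - b 4) * p 3 x - a 3 * p 2 x"
        by (rule p) simp_all
      ultimately show ?thesis unfolding b by algebra
    qed
    have "smult (4 * (b 4 - d)) (?y * ?P 3) + smult (4 * a 3) (?y * ?P 2)
          - smult (a 4) (?y * pderiv (?P 3)) = smult (4 * a 5 - 5 * a 4) (?P 3)" (is "?l = ?r")
    proof (rule poly_ext)
      fix x
      show "poly ?l x = poly ?r x"
        using id[of x] unfolding p_def q_def
        by (simp only: poly_add poly_diff poly_smult poly_mult poly_pCons poly_0) simp
    qed
    hence "coeff ?l (Suc 3) = coeff ?r (Suc 3)"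
      by (rule arg_cong)
    moreover have "coeff (?P 3) 4 = 0" "coeff (?P 2) 4 = 0" "coeff (?P 2) 3 = 0"
      "coeff (pderiv (?P 3)) 4 = 0" "coeff (pderiv (?P 3)) 3 = 0" "coeff (?P 3) 3 = 1"
      using coeff_recurrence_poly[of a b 3]
      by (simp_all add: coeff_eq_0 degree_pderiv)
    ultimately show ?thesis
      unfolding coeff_add coeff_diff coeff_smult coeff_linear_mult by simp
  qed
  \<comment> \<open>With b_4 = d, \<open>A\<close> for k = 0 at d leaves a_3 P_1(d) = 0. Then b_2
    follows from P_2' = 2 P_1, and b_3 from the recurrence for P_3 at d.\<close>
  have b1: "b 1 = d"
  proof -
    have "p 1 d = 0"
      using A[where k = 0 and x = d] b4 p3_root a[of 3] by simp
    thus ?thesis unfolding p01 by simp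
  qed
  have b2: "b 2 = d"
  proof -
    have "q 2 0 = p 1 0 + (0 - b 2) * q 1 0 - a 1 * q 0 0"
      by (rule q) simp_all
    thus ?thesis
      using q2[of 0] unfolding p01 q01 b1 by simp
  qed
  have b3: "b 3 = d"
  proof -
    have "p 2 d \<noteq> 0"
      using p3_root by (rule p_nz) simp
    moreover have "p 3 d = (d - b 3) * p 2 d - a 2 * p 1 d"
      by (rule p) simp_all
    ultimately show ?thesis
      unfolding p01 b1 p3_root by simp
  qed
  have b: "b n = d" if "n \<ge> 1" for n
  proof (cases "n \<ge> 5")
    case True
    hence "\<exists>k. n = 2 * k + 5 \<or> n = 2 * k + 6"
      by presburger
    thus ?thesis using b_ge5 by blast
  next
    case False
    hence "n = 1 \<or> n = 2 \<or> n = 3 \<or> n = 4"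
      using that by linarith
    thus ?thesis using b1 b2 b3 b4 by blast
  qed
  have py: "p l x = (x - d) * p m x - a m * p n x"
    and qy: "q l x = p m x + (x - d) * q m x - a m * q n x" if "m = Suc n" "l = Suc m" for l m n x
    using p[OF that] q[OF that] b[of l] that(2) by simp_all
  have A': "(x - d) * q (2 * k + 3) x =
      (2 * real k + 3) * p (2 * k + 3) x + (2 * real k + 2) * a (2 * k + 3) * p (2 * k + 1) x" for k x
    using A[where k = k and x = x] b[of "2 * k + 4"] by simp
  have a3: "a 3 = a 1 + a 2"
  proof -
    \<comment> \<open>Evaluating where x - d = 1 turns the k = 0 identity into arithmetic in a_1,
      a_2, a_3. The result starts the odd recursion, with a_3 - a_1 = a_2 = 2 s.\<close>
    let ?x = "d + 1"
    have "p 1 ?x = 1" "p 0 ?x = 1" "q 1 ?x = 1" "q 2 ?x = 2 * p 1 ?x"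
      using q2[of ?x] unfolding p01 q01 b1 by simp_all
    moreover have "p 2 ?x = (?x - d) * p 1 ?x - a 1 * p 0 ?x"
      "p 3 ?x = (?x - d) * p 2 ?x - a 2 * p 1 ?x"
      "q 3 ?x = p 2 ?x + (?x - d) * q 2 ?x - a 2 * q 1 ?x"
      by (rule py qy; simp)+
    moreover have "q 3 ?x = 3 * p 3 ?x + 2 * a 3 * p 1 ?x"
      using A'[where k = 0 and x = ?x] by simp
    ultimately show ?thesis by simp
  qed
  have a_step: "(real k + 2) * a (2 * k + 5) = (real k + 2) * a (2 * k + 3) + a (2 * k + 4) \<and>
      (real k + 1) * a (2 * k + 4) = (real k + 2) * a (2 * k + 2)" for k
  proof -
    \<comment> \<open>Eliminating all other polynomials from the identities for k and k + 1 leaves C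
      P_{2k+3} = D P_{2k+1}. The degrees differ, so C = D = 0, and these are the two claimed
      recursions up to a factor 2 and, for D, the nonzero factor a_{2k+3}.\<close>
    define C where "C = (2 * real k + 4) * a (2 * k + 3) + 2 * a (2 * k + 4) - (2 * real k + 4) * a (2 * k + 5)"
    define D where "D = (2 * real k + 2) * a (2 * k + 4) * a (2 * k + 3) - (2 * real k + 4) * a (2 * k + 3) * a (2 * k + 2)"
    have id: "C * p (2 * k + 3) x = D * p (2 * k + 1) x" for x
    proof -
      have "q (2 * k + 4) x = (2 * real k + 4) * p (2 * k + 3) x"
        using q_even[of "2 * k + 4" "k + 1" "2 * k + 3" x] by (simp add: algebra_simps)
      moreover have "(x - d) * q (2 * k + 5) x = (2 * real k + 5) * p (2 * k + 5) x
          + (2 * real k + 4) * a (2 * k + 5) * p (2 * k + 3) x"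
      proof -
        have i: "2 * (k + 1) + 3 = 2 * k + 5" "2 * (k + 1) + 1 = 2 * k + 3"
          by simp_all
        show ?thesis
          using A'[where k = "k + 1" and x = x] unfolding i by (simp add: algebra_simps)
      qed
      moreover have "p (2 * k + 5) x = (x - d) * p (2 * k + 4) x - a (2 * k + 4) * p (2 * k + 3) x"
        by (rule py) simp_all
      moreover have "q (2 * k + 5) x = p (2 * k + 4) x + (x - d) * q (2 * k + 4) x - a (2 * k + 4) * q (2 * k + 3) x"
        by (rule qy) simp_all
      moreover have "p (2 * k + 4) x = (x - d) * p (2 * k + 3) x - a (2 * k + 3) * p (2 * k + 2) x"
        by (rule py) simp_all
      moreover have "p (2 * k + 3) x = (x - d) * p (2 * k + 2) x - a (2 * k + 2) * p (2 * k + 1) x"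
        by (rule py) simp_all
      ultimately show ?thesis
        using A'[where k = k and x = x] unfolding C_def D_def by algebra
    qed
    have "smult C (recurrence_poly a b (2 * k + 3)) = smult D (recurrence_poly a b (2 * k + 1))"
    proof (rule poly_ext)
      fix x
      show "poly (smult C (recurrence_poly a b (2 * k + 3))) x = poly (smult D (recurrence_poly a b (2 * k + 1))) x"
        using id[of x] by (simp only: p_def poly_smult)
    qed
    hence coeffs: "C * coeff (recurrence_poly a b (2 * k + 3)) n = D * coeff (recurrence_poly a b (2 * k + 1)) n" for n
      by (metis coeff_smult)
    have C: "C = 0"
      using coeffs[of "2 * k + 3"] by (simp add: coeff_eq_0)
    have "D = 0"
      using coeffs[of "2 * k + 1"] C by simp
    hence "a (2 * k + 3) * ((2 * real k + 2) * a (2 * k + 4) - (2 * real k + 4) * a (2 * k + 2)) = 0"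
      unfolding D_def by (simp add: algebra_simps)
    hence "(2 * real k + 2) * a (2 * k + 4) - (2 * real k + 4) * a (2 * k + 2) = 0"
      using a[of "2 * k + 3"] by simp
    thus ?thesis
      using C unfolding C_def by (simp add: algebra_simps)
  qed
  define s where "s = a 2 / 2"
  have s: "s > 0"
    using a[of 2] by (simp add: s_def)
  have even: "a (2 * k + 2) = (2 * real k + 2) * s" for k
  proof (induction k)
    case (Suc k)
    have "(real k + 1) * a (2 * k + 4) = (real k + 1) * ((2 * real k + 4) * s)"
      using a_step[of k] Suc by (simp add: algebra_simps)
    hence "a (2 * k + 4) = (2 * real k + 4) * s"
      by (subst (asm) mult_left_cancel) simp_all
    moreover have "2 * Suc k + 2 = 2 * k + 4"
      by simp
    ultimately show ?case
      by (simp only:) simp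
  qed (simp add: s_def numeral_2_eq_2)
  have odd: "a (2 * k + 1) = a 1 + 2 * real k * s" for k
  proof (induction k)
    case (Suc k)
    show ?case
    proof (cases k)
      case 0
      thus ?thesis using a3 by (simp add: s_def numeral_3_eq_3)
    next
      case (Suc j)
      have "(real j + 2) * a (2 * j + 5) = (real j + 2) * (a (2 * j + 3) + 2 * s)"
      proof -
        have "2 * (j + 1) + 2 = 2 * j + 4"
          by simp
        hence "a (2 * j + 4) = (2 * real (j + 1) + 2) * s"
          using even[of "j + 1"] by (simp only:)
        thus ?thesis
          using conjunct1[OF a_step[of j]] by (simp add: algebra_simps)
      qed
      hence "a (2 * j + 5) = a (2 * j + 3) + 2 * s"
        by (subst (asm) mult_left_cancel) simp_all
      moreover have "2 * Suc (Suc j) + 1 = 2 * j + 5" "2 * Suc j + 1 = 2 * j + 3"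
        by simp_all
      ultimately show ?thesis
        using Suc.IH unfolding Suc by (simp only:) (simp add: algebra_simps)
    qed
  qed simp
  \<comment> \<open>gamma solves a_1 = (1 + gamma) s, as s solves a_2 = 2 s.\<close>
  have "hermite_coeffs (a 1 / s - 1) s d a b"
    unfolding hermite_coeffs_def using b even odd s by (simp add: field_simps)
  moreover have "a 1 / s - 1 > -1"
    using a[of 1] s by simp
  ultimately show ?thesis
    using s by blast
qed

section \<open>From property (P) to recurrence coefficients and back\<close>

context infinite_moments
begin

lemma property_P_of_hermite_coeffs:
  assumes ab: "recurrence_coeffs \<mu> a b" and H: "hermite_coeffs \<gamma> s d a b" and \<gamma>: "\<gamma> > -1" and s: "s > 0"
  shows "property_P \<mu>"
  unfolding property_P_def
proof (intro exI[of _ d] allI impI)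
  fix n :: nat assume n: "n \<ge> 1"
  define \<nu> where "\<nu> = reversed_measure \<mu> n"
  have S: "measure_support \<nu> = recurrence_roots a b (Suc n)"
    unfolding \<nu>_def by (rule measure_support_reversed_measure[OF ab])
  have m: "measure \<nu> {x} = reversed_weight a b n x" if "x \<in> recurrence_roots a b (Suc n)" for x
    unfolding \<nu>_def by (rule measure_reversed_measure_singleton[OF ab that])
  have card: "card (recurrence_roots a b (Suc n)) = Suc n"
    by (rule card_recurrence_roots) (rule recurrence_coeffs_pos[OF ab])
  have "\<exists>w. \<forall>x\<in>measure_support \<nu>. measure \<nu> {x} = w" if "odd n"
  proof -
    obtain k where k: "n = 2 * k + 1"
      using \<open>odd n\<close> by (rule oddE)
    have "measure \<nu> {x} = 1 / (2 * real k + 2)" if x: "x \<in> recurrence_roots a b (Suc n)" for x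
    proof -
      have "x \<in> recurrence_roots a b (2 * k + 2)"
        using x k by simp
      from hermite_coeffs_weights(1)[OF H \<gamma> s this] show ?thesis
        unfolding m[OF x] k .
    qed
    thus ?thesis
      unfolding S by blast
  qed
  moreover have "d \<in> measure_support \<nu> \<and> measure \<nu> {d} > 0 \<and>
      (\<exists>w. \<forall>x\<in>measure_support \<nu> - {d}. measure \<nu> {x} = w)" if "even n"
  proof -
    obtain k where k: "n = 2 * k"
      using \<open>even n\<close> by (rule evenE)
    have d: "d \<in> recurrence_roots a b (Suc n)"
      using hermite_coeffs_root[OF H, of k] k by simp
    have "reversed_weight a b n d > 0"
      by (rule reversed_weight_pos[OF recurrence_coeffs_pos[OF ab] d])
    moreover have "measure \<nu> {x} = 1 / (2 * real k + 1 + \<gamma>)"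
      if x: "x \<in> recurrence_roots a b (Suc n) - {d}" for x
    proof -
      have "x \<in> recurrence_roots a b (2 * k + 1)" and ne: "x \<noteq> d"
        and x': "x \<in> recurrence_roots a b (Suc n)"
        using x k by simp_all
      from hermite_coeffs_weights(2)[OF H \<gamma> s this(1,2)] show ?thesis
        unfolding m[OF x'] k .
    qed
    ultimately show ?thesis
      unfolding S using m[OF d] d by auto
  qed
  ultimately show "let \<nu> = reversed_measure \<mu> n; S = measure_support \<nu> in
          (odd n \<longrightarrow> card S = n + 1 \<and> (\<exists>w. \<forall>x\<in>S. measure \<nu> {x} = w)) \<and>
          (even n \<longrightarrow> d \<in> S \<and> measure \<nu> {d} > 0 \<and>
             card (S - {d}) = n \<and> (\<exists>w. \<forall>x\<in>S - {d}. measure \<nu> {x} = w))"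
    unfolding Let_def \<nu>_def[symmetric] S using card by simp
qed

lemma hermite_coeffs_of_property_P:
  assumes ab: "recurrence_coeffs \<mu> a b" and P: "property_P \<mu>"
  shows "\<exists>\<gamma> s d. \<gamma> > -1 \<and> s > 0 \<and> hermite_coeffs \<gamma> s d a b"
proof -
  note S = measure_support_reversed_measure[OF ab] and m = measure_reversed_measure_singleton[OF ab]
  obtain d where D: "\<forall>n\<ge>1. let \<nu> = reversed_measure \<mu> n; S = measure_support \<nu> in
          (odd n \<longrightarrow> card S = n + 1 \<and> (\<exists>w. \<forall>x\<in>S. measure \<nu> {x} = w)) \<and>
          (even n \<longrightarrow> d \<in> S \<and> measure \<nu> {d} > 0 \<and>
             card (S - {d}) = n \<and> (\<exists>w. \<forall>x\<in>S - {d}. measure \<nu> {x} = w))"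
    using P unfolding property_P_def by (elim exE)
  have d: "\<exists>w. \<forall>x\<in>measure_support (reversed_measure \<mu> n). measure (reversed_measure \<mu> n) {x} = w"
      if "n \<ge> 1" "odd n" for n
    using D[rule_format, OF that(1)] that(2) unfolding Let_def by blast
  have d': "d \<in> measure_support (reversed_measure \<mu> n)" if "n \<ge> 1" "even n" for n
    using D[rule_format, OF that(1)] that(2) unfolding Let_def by blast
  have "pderiv (recurrence_poly a b (2 * k + 2)) = smult (2 * real k + 2) (recurrence_poly a b (2 * k + 1))" for k
  proof -
    obtain w where "\<And>x. x \<in> recurrence_roots a b (Suc (2 * k + 1)) \<Longrightarrow> reversed_weight a b (2 * k + 1) x = w"
    proof -
      have n: "2 * k + 1 \<ge> 1" "odd (2 * k + 1)"
        by simp_all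
      from d[OF n] obtain w where
        "\<forall>x\<in>recurrence_roots a b (Suc (2 * k + 1)). measure (reversed_measure \<mu> (2 * k + 1)) {x} = w"
        unfolding S by blast
      hence "reversed_weight a b (2 * k + 1) x = w" if "x \<in> recurrence_roots a b (Suc (2 * k + 1))" for x
        using m[OF that] that by simp
      thus thesis by (rule that)
    qed
    from pderiv_eq_of_equal_weights[OF recurrence_coeffs_pos[OF ab] this] show ?thesis
      by (simp add: add.commute)
  qed
  from hermite_coeffs_of_pderiv_and_root[OF recurrence_coeffs_pos[OF ab] this]
  have *: "\<exists>\<gamma> s. \<gamma> > -1 \<and> s > 0 \<and> hermite_coeffs \<gamma> s d a b"
    if "\<And>k. poly (recurrence_poly a b (2 * k + 3)) d = 0" for d
    using that by blast
  have "poly (recurrence_poly a b (2 * k + 3)) d = 0" for k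
  proof -
    have n: "2 * k + 2 \<ge> 1" "even (2 * k + 2)" "Suc (2 * k + 2) = 2 * k + 3"
      by simp_all
    show ?thesis
      using d'[OF n(1,2)] unfolding S n(3) by (simp add: recurrence_roots_def)
  qed
  from *[OF this] show ?thesis
    by blast
qed

lemma reversed_measure_even_weights:
  assumes ab: "recurrence_coeffs \<mu> a b" and H: "hermite_coeffs \<gamma> s d a b" and \<gamma>: "\<gamma> > -1" and s: "s > 0"
  shows "d \<in> measure_support (reversed_measure \<mu> (2 * m))"
    and "card (measure_support (reversed_measure \<mu> (2 * m)) - {d}) = 2 * m"
    and "x \<in> measure_support (reversed_measure \<mu> (2 * m)) - {d} \<Longrightarrow>
      measure (reversed_measure \<mu> (2 * m)) {d} = (\<gamma> + 1) * measure (reversed_measure \<mu> (2 * m)) {x}"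
proof -
  have S: "measure_support (reversed_measure \<mu> (2 * m)) = recurrence_roots a b (2 * m + 1)"
    using measure_support_reversed_measure[OF ab, of "2 * m"] by simp
  have d: "d \<in> recurrence_roots a b (2 * m + 1)"
    by (rule hermite_coeffs_root[OF H])
  thus "d \<in> measure_support (reversed_measure \<mu> (2 * m))"
    by (simp add: S)
  have "card (recurrence_roots a b (2 * m + 1)) = 2 * m + 1"
    by (rule card_recurrence_roots) (rule recurrence_coeffs_pos[OF ab])
  thus "card (measure_support (reversed_measure \<mu> (2 * m)) - {d}) = 2 * m"
    using d by (simp add: S)
  assume x: "x \<in> measure_support (reversed_measure \<mu> (2 * m)) - {d}"
  have mm: "measure (reversed_measure \<mu> (2 * m)) {x} = reversed_weight a b (2 * m) x"
    if "x \<in> recurrence_roots a b (2 * m + 1)" for x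
    using measure_reversed_measure_singleton[OF ab, of x "2 * m"] that by simp
  show "measure (reversed_measure \<mu> (2 * m)) {d} = (\<gamma> + 1) * measure (reversed_measure \<mu> (2 * m)) {x}"
    using x hermite_coeffs_weights(2,3)[OF H \<gamma> s, where k = m] mm[of x] mm[OF d] by (simp add: S)
qed

end

context finite_moments
begin

text \<open>The assumption is orthogonality to P_0 = 1. Inside L the recurrence shifts the factor x
  from P_{m+1} to P_n, so orthogonality of P_m and P_{m+1} to all later polynomials passes to
  P_{m+2}.\<close>

lemma recurrence_coeffs_of_L_eq_0:
  assumes zero: "\<And>n. n \<ge> 1 \<Longrightarrow> L (recurrence_poly a b n) = 0"
  shows "recurrence_coeffs \<mu> a b"
proof -
  let ?P = "recurrence_poly a b" and ?x = "[:0, 1:] :: real poly"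
  have rec: "?P (Suc (Suc n)) = ?x * ?P (Suc n) - smult (b (n + 2)) (?P (Suc n)) - smult (a (n + 1)) (?P n)" for n
    by (simp add: recurrence_poly.simps(3) algebra_simps)
  have "(\<forall>n>m. L (?P m * ?P n) = 0) \<and> (\<forall>n>Suc m. L (?P (Suc m) * ?P n) = 0)" for m
  proof (induction m)
    case 0
    have "L (?P (Suc 0) * ?P n) = 0" if n: "n > Suc 0" for n
    proof -
      obtain k where k: "n = Suc (Suc k)"
        using less_imp_Suc_add[OF n] by auto
      have "?P (Suc 0) * ?P n = ?P (Suc n) + smult (b (Suc n) - b 1) (?P n) + smult (a n) (?P (Suc k))"
        unfolding k by (simp add: recurrence_poly.simps(3)[of _ _ "Suc k"] algebra_simps smult_diff_left)
      thus ?thesis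
        using zero k by simp
    qed
    thus ?case
      using zero by (simp del: recurrence_poly.simps(2))
  next
    case (Suc m)
    have "L (?P (Suc (Suc m)) * ?P n) = 0" if n: "n > Suc (Suc m)" for n
    proof -
      obtain k where k: "n = Suc (Suc k)"
        using less_imp_Suc_add[OF n] by auto
      have "?P (Suc (Suc m)) * ?P n =
          ?P (Suc m) * ?P (Suc n) + smult (b (Suc n) - b (m + 2)) (?P (Suc m) * ?P n)
          + smult (a n) (?P (Suc m) * ?P (Suc k)) - smult (a (m + 1)) (?P m * ?P n)"
        unfolding k
        by (simp add: recurrence_poly.simps(3)[of _ _ "Suc k"] recurrence_poly.simps(3)[of _ _ m]
             algebra_simps smult_diff_left)
      moreover have "m < n" "Suc m < n" "Suc m < Suc n" "Suc m < Suc k"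
        using n k by simp_all
      ultimately show ?thesis
        using Suc.IH by simp
    qed
    thus ?case
      using Suc.IH by blast
  qed
  hence lt: "L (?P m * ?P n) = 0" if "m < n" for m n
    using that by blast
  have "L (?P m * ?P n) = 0" if "m \<noteq> n" for m n
    using that lt[of m n] lt[of n m] by (auto simp: mult.commute[of "?P n"] neq_iff)
  thus ?thesis
    unfolding recurrence_coeffs_iff monic_orthogonal_polys_iff by simp
qed

text \<open>The identity assumed for \<open>L\<close> is integration by parts against the weight; it yields
  two-step recursions for the numbers \<open>L (P n)\<close>.\<close>

lemma recurrence_coeffs_of_pearson:
  assumes H: "hermite_coeffs \<gamma> s d a b" and 1: "L [:- d, 1:] = 0"
    and pearson: "\<And>p. s * L ([:- d, 1:] * pderiv p + smult (\<gamma> + 1) p) = L ([:- d, 1:] ^ 2 * p)"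
  shows "recurrence_coeffs \<mu> a b"
proof (rule recurrence_coeffs_of_L_eq_0)
  let ?P = "recurrence_poly a b" and ?y = "[:- d, 1:]"
  \<comment> \<open>The Pearson identity says that L annihilates \<open>T p\<close>. For every n, T
    P_n = - s n P_n - P_{n+2}, hence L(P_{n+2}) = - s n L(P_n); the chains start from L(P_1) = 0
    and, at n = 0, from L(P_2) = 0.\<close>
  define T where "T p = smult s (?y * pderiv p + smult (\<gamma> + 1) p) - ?y ^ 2 * p" for p
  have LT: "L (T p) = 0" for p
    using pearson[of p] by (simp add: T_def del: mult_pCons_left)
  note p = hermite_coeffs_rec[OF H] and q = hermite_coeffs_pderiv[OF H]
  have T_poly: "poly (T p) x = s * ((x - d) * poly (pderiv p) x + (\<gamma> + 1) * poly p x) - (x - d)\<^sup>2 * poly p x"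
    for p x
    by (simp only: T_def poly_diff poly_add poly_smult poly_mult poly_power poly_pCons poly_0) simp
  have P1: "?P 1 = ?y"
    using H by (simp add: hermite_coeffs_def)
  have P2: "T (?P 0) = - ?P 2"
  proof (rule poly_ext)
    fix x
    have "poly (?P 2) x = (x - d) * (x - d) - (1 + \<gamma>) * s"
      using p(1)[where k = 0 and x = x] P1 by (simp add: numeral_2_eq_2)
    thus "poly (T (?P 0)) x = poly (- ?P 2) x"
      by (simp add: T_poly algebra_simps power2_eq_square)
  qed
  have odd: "T (?P (2 * k + 1)) = - smult (s * (2 * real k + 1)) (?P (2 * k + 1)) - ?P (2 * k + 3)" for k
  proof (rule poly_ext)
    fix x
    have "poly (T (?P (2 * k + 1))) x = - (s * (2 * real k + 1)) * poly (?P (2 * k + 1)) x - poly (?P (2 * k + 3)) x"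
      unfolding T_poly using p[of k x] q(2)[of x k] by algebra
    thus "poly (T (?P (2 * k + 1))) x = poly (- smult (s * (2 * real k + 1)) (?P (2 * k + 1)) - ?P (2 * k + 3)) x"
      by simp
  qed
  have even: "T (?P (2 * k + 2)) = - smult (s * (2 * real k + 2)) (?P (2 * k + 2)) - ?P (2 * k + 4)" for k
  proof (rule poly_ext)
    fix x
    have "poly (?P (2 * k + 4)) x = (x - d) * poly (?P (2 * k + 3)) x - (2 * real k + 3 + \<gamma>) * s * poly (?P (2 * k + 2)) x"
      using p(1)[of "k + 1" x] by (simp add: algebra_simps numeral_eq_Suc)
    hence "poly (T (?P (2 * k + 2))) x = - (s * (2 * real k + 2)) * poly (?P (2 * k + 2)) x - poly (?P (2 * k + 4)) x"
      unfolding T_poly using p[of k x] q(1)[of k x] by algebra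
    thus "poly (T (?P (2 * k + 2))) x = poly (- smult (s * (2 * real k + 2)) (?P (2 * k + 2)) - ?P (2 * k + 4)) x"
      by simp
  qed
  have L_uminus: "L (- p) = - L p" for p
    using L_smult[of "-1" p] by simp
  have L_odd: "L (?P (2 * k + 1)) = 0" for k
  proof (induction k)
    case 0
    show ?case using 1 P1 by simp
  next
    case (Suc k)
    have "2 * Suc k + 1 = 2 * k + 3" by simp
    thus ?case
      using LT[of "?P (2 * k + 1)"] Suc unfolding odd by (simp only: L_diff L_uminus L_smult)
  qed
  have L_even: "L (?P (2 * k + 2)) = 0" for k
  proof (induction k)
    case 0
    show ?case using LT[of "?P 0"] unfolding P2 by (simp add: L_uminus numeral_2_eq_2)
  next
    case (Suc k)
    have "2 * Suc k + 2 = 2 * k + 4" by simp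
    thus ?case
      using LT[of "?P (2 * k + 2)"] Suc unfolding even by (simp only: L_diff L_uminus L_smult)
  qed
  fix n :: nat assume "n \<ge> 1"
  hence "(\<exists>k. n = 2 * k + 1) \<or> (\<exists>k. n = 2 * k + 2)"
    by presburger
  thus "L (?P n) = 0"
    using L_odd L_even by blast
qed

end

lemma ex_hermite_coeffs: "\<exists>a b. hermite_coeffs \<gamma> s d a b"
proof -
  have "hermite_coeffs \<gamma> s d (\<lambda>n. if odd n then (real n + \<gamma>) * s else real n * s) (\<lambda>_. d)"
    by (simp add: hermite_coeffs_def algebra_simps)
  thus ?thesis by blast
qed

section \<open>The generalized Hermite weight\<close>

lemma power_le_fact_mult_exp: "x ^ n \<le> fact n * exp x" if "x \<ge> 0" for x :: real
proof -
  have "(\<Sum>i\<in>{n}. x ^ i /\<^sub>R fact i) \<le> exp x"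
    unfolding exp_def by (rule sum_le_suminf) (use that summable_exp_generic[of x] in auto)
  thus ?thesis
    by (simp add: field_simps)
qed

lemma borel_measurable_poly [measurable]: "poly p \<in> borel_measurable borel" for p :: "real poly"
  by (intro borel_measurable_continuous_onI continuous_intros)

lemma gen_hermite_weight_nonneg: "gen_hermite_weight \<gamma> x \<ge> 0"
  by (simp add: gen_hermite_weight_def)

lemma borel_measurable_gen_hermite_weight [measurable]: "gen_hermite_weight \<gamma> \<in> borel_measurable borel"
  unfolding gen_hermite_weight_def[abs_def] by measurable

lemma gen_hermite_weight_minus: "gen_hermite_weight \<gamma> (- x) = gen_hermite_weight \<gamma> x"
  by (simp add: gen_hermite_weight_def)

text \<open>On the half-line the function is dominated by a multiple of the integrand of Gamma(gamma
  + 1), which is where gamma > -1 enters; evenness does the rest. Finite moments and determinacy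
  both rest on this bound.\<close>

lemma integrable_exp_gen_hermite_weight:
  assumes "\<gamma> > -1"
  shows "integrable lborel (\<lambda>x. exp (t * \<bar>x\<bar>) * gen_hermite_weight \<gamma> x)"
proof -
  let ?f = "\<lambda>x. exp (t * \<bar>x\<bar>) * gen_hermite_weight \<gamma> x"
  let ?g = "\<lambda>x::real. indicator {0..} x * x powr (\<gamma> + 1 - 1) / exp x"
  have "integrable lborel ?g"
  proof (rule integrableI_nonneg)
    show "(\<integral>\<^sup>+ x. ennreal (?g x) \<partial>lborel) < \<infinity>"
      by (subst Gamma_conv_nn_integral_real[symmetric]) (use assms in auto)
  qed auto
  hence "integrable lborel (\<lambda>x. exp ((t + 1)\<^sup>2 / 4) * ?g x)"
    by (rule integrable_mult_right)
  hence "integrable lborel (\<lambda>x. indicator {0..} x *\<^sub>R ?f x)"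
  proof (rule Bochner_Integration.integrable_bound)
    have "norm (indicator {0..} x *\<^sub>R ?f x) \<le> norm (exp ((t + 1)\<^sup>2 / 4) * ?g x)" for x :: real
    proof (cases "x \<ge> 0")
      case True
      \<comment> \<open>Completing the square in t x - x^2 + x; its maximum is the constant (t +
        1)^2 / 4.\<close>
      have "(x - (t + 1) / 2)\<^sup>2 \<ge> 0"
        by simp
      hence "t * x - x\<^sup>2 \<le> (t + 1)\<^sup>2 / 4 - x"
        by (simp add: power2_eq_square field_simps)
      hence "exp (t * x) * exp (- x\<^sup>2) \<le> exp ((t + 1)\<^sup>2 / 4) / exp x"
        by (simp add: exp_add[symmetric] exp_diff[symmetric])
      hence "x powr \<gamma> * (exp (t * x) * exp (- x\<^sup>2)) \<le> x powr \<gamma> * (exp ((t + 1)\<^sup>2 / 4) / exp x)"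
        by (rule mult_left_mono) simp
      thus ?thesis
        using True by (simp add: gen_hermite_weight_def abs_mult mult_ac)
    qed simp
    thus "AE x in lborel. norm (indicator {0..} x *\<^sub>R ?f x) \<le> norm (exp ((t + 1)\<^sup>2 / 4) * ?g x)"
      by simp
  qed measurable
  hence "has_bochner_integral lborel (\<lambda>x. indicator {0..} x *\<^sub>R ?f x)
      (\<integral>x. indicator {0..} x *\<^sub>R ?f x \<partial>lborel)"
    by (rule has_bochner_integral_integrable)
  from has_bochner_integral_even_function[OF this] show ?thesis
    by (auto simp: gen_hermite_weight_minus has_bochner_integral_iff)
qed

lemma integrable_power_gen_hermite_weight:
  assumes "\<gamma> > -1"
  shows "integrable lborel (\<lambda>x. x ^ k * gen_hermite_weight \<gamma> x)"
proof (rule Bochner_Integration.integrable_bound)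
  show "integrable lborel (\<lambda>x. fact k * (exp (1 * \<bar>x\<bar>) * gen_hermite_weight \<gamma> x))"
    by (intro integrable_mult_right integrable_exp_gen_hermite_weight assms)
  have "norm (x ^ k * gen_hermite_weight \<gamma> x) \<le> norm (fact k * (exp (1 * \<bar>x\<bar>) * gen_hermite_weight \<gamma> x))" for x
    using mult_right_mono[OF power_le_fact_mult_exp[of "\<bar>x\<bar>" k] gen_hermite_weight_nonneg[of \<gamma> x]]
    by (simp add: abs_mult power_abs gen_hermite_weight_nonneg mult.assoc)
  thus "AE x in lborel. norm (x ^ k * gen_hermite_weight \<gamma> x)
      \<le> norm (fact k * (exp (1 * \<bar>x\<bar>) * gen_hermite_weight \<gamma> x))"
    by simp
qed measurable

text \<open>On (0, oo) the integrand is the derivative of x^(k + 1 + gamma) exp(-x^2), whose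
  boundary values vanish since k + 1 + gamma > 0; parity in k extends the result to the whole
  line.\<close>

lemma gen_hermite_weight_by_parts:
  assumes \<gamma>: "\<gamma> > -1"
  shows "has_bochner_integral lborel
    (\<lambda>x. ((real k + 1 + \<gamma>) * x ^ k - 2 * x ^ (k + 2)) * gen_hermite_weight \<gamma> x) 0"
proof -
  let ?f = "\<lambda>x. ((real k + 1 + \<gamma>) * x ^ k - 2 * x ^ (k + 2)) * gen_hermite_weight \<gamma> x"
  let ?F = "\<lambda>x. x powr (real k + 1 + \<gamma>) * exp (- x\<^sup>2)"
  have int: "integrable lborel ?f"
    unfolding left_diff_distrib mult.assoc
    by (intro Bochner_Integration.integrable_diff integrable_mult_right integrable_power_gen_hermite_weight \<gamma>)
  have deriv: "(?F has_vector_derivative ?f x) (at x)" if "x > 0" for x :: real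
  proof -
    have "(?F has_real_derivative ((real k + 1 + \<gamma>) * x powr (real k + 1 + \<gamma> - 1) * exp (- x\<^sup>2)
        + exp (- x\<^sup>2) * (- (2 * x)) * x powr (real k + 1 + \<gamma>))) (at x)"
      using that by (auto intro!: derivative_eq_intros)
    moreover have "x powr (real k + 1 + \<gamma> - 1) = x ^ k * x powr \<gamma>"
      "x powr (real k + 1 + \<gamma>) = x ^ (k + 1) * x powr \<gamma>"
      using that by (simp_all add: powr_add powr_realpow)
    ultimately show ?thesis
      using that unfolding has_real_derivative_iff_has_vector_derivative[symmetric]
      by (simp add: gen_hermite_weight_def algebra_simps power2_eq_square)
  qed
  have exponent: "real k + 1 + \<gamma> > 0"
    using \<gamma> by linarith
  have "(LBINT x=0..\<infinity>. ?f x) = 0 - 0"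
  proof (rule interval_integral_FTC_integrable)
    show "(?F has_vector_derivative ?f x) (at x)" if "0 < ereal x" for x
      using that deriv by (simp add: zero_ereal_def)
    show "isCont ?f x" if "0 < ereal x" for x
      unfolding gen_hermite_weight_def using that by (intro continuous_intros) (auto simp: zero_ereal_def)
    show "set_integrable lborel (einterval 0 \<infinity>) ?f"
      unfolding set_integrable_def using int by (intro integrable_mult_indicator) auto
    have "(?F \<longlongrightarrow> 0) (at_right 0)"
      using exponent by real_asymp
    thus "((?F \<circ> real_of_ereal) \<longlongrightarrow> 0) (at_right 0)"
      by (simp only: zero_ereal_def ereal_tendsto_simps1)
    have "(?F \<longlongrightarrow> 0) at_top"
      using exponent by real_asymp
    thus "((?F \<circ> real_of_ereal) \<longlongrightarrow> 0) (at_left \<infinity>)"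
      by (simp only: ereal_tendsto_simps1)
  qed simp
  \<comment> \<open>Pointwise also at 0, since \<open>0 powr \<gamma> = 0\<close> makes the weight
    vanish there.\<close>
  moreover have "indicator {0<..} x *\<^sub>R ?f x = indicator {0..} x *\<^sub>R ?f x" for x :: real
    by (cases "x = 0") (auto simp: gen_hermite_weight_def indicator_def)
  ultimately have "(\<integral>x. indicator {0..} x *\<^sub>R ?f x \<partial>lborel) = 0"
    by (simp only: interval_lebesgue_integral_0_infty set_lebesgue_integral_def)
  moreover have "integrable lborel (\<lambda>x. indicator {0..} x *\<^sub>R ?f x)"
    using int by (intro integrable_mult_indicator) auto
  ultimately have half: "has_bochner_integral lborel (\<lambda>x. indicator {0..} x *\<^sub>R ?f x) 0"
    by (simp only: has_bochner_integral_iff)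
  show ?thesis
  proof (cases "even k")
    case True
    with has_bochner_integral_even_function[OF half] show ?thesis
      by (simp add: gen_hermite_weight_minus)
  next
    case False
    with has_bochner_integral_odd_function[OF half] show ?thesis
      by (simp add: gen_hermite_weight_minus algebra_simps)
  qed
qed

text \<open>The power x^k makes the induction on \<open>p\<close> possible: in a + x p the constant
  is covered by the monomial case, and the factor x is absorbed into x^(k + 1). The case k = 0 is
  the one applied later.\<close>

lemma gen_hermite_weight_pearson:
  assumes \<gamma>: "\<gamma> > -1"
  shows "has_bochner_integral lborel
    (\<lambda>x. (x * poly (pderiv p) x + (real k + 1 + \<gamma>) * poly p x - 2 * x\<^sup>2 * poly p x) * x ^ k
       * gen_hermite_weight \<gamma> x) 0"
proof (induction p arbitrary: k)
  case (pCons a p)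
  have "has_bochner_integral lborel
     (\<lambda>x. a * (((real k + 1 + \<gamma>) * x ^ k - 2 * x ^ (k + 2)) * gen_hermite_weight \<gamma> x)
      + (x * poly (pderiv p) x + (real (Suc k) + 1 + \<gamma>) * poly p x - 2 * x\<^sup>2 * poly p x) * x ^ Suc k
       * gen_hermite_weight \<gamma> x) (a * 0 + 0)"
    by (intro has_bochner_integral_add has_bochner_integral_mult_right
          gen_hermite_weight_by_parts \<gamma> pCons.IH)
  thus ?case
    by (rule has_bochner_integral_cong[THEN iffD1, rotated -1])
       (simp_all add: pderiv_pCons algebra_simps power2_eq_square)
qed (simp add: has_bochner_integral_zero)

lemma gen_hermite_weight_integral_pos:
  assumes "\<gamma> > -1"
  shows "(\<integral>x. gen_hermite_weight \<gamma> x \<partial>lborel) > 0"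
proof -
  have int: "integrable lborel (gen_hermite_weight \<gamma>)"
    using integrable_power_gen_hermite_weight[OF assms, of 0] by simp
  have "(\<integral>x. gen_hermite_weight \<gamma> x \<partial>lborel) \<noteq> 0"
  proof
    assume "(\<integral>x. gen_hermite_weight \<gamma> x \<partial>lborel) = 0"
    hence "AE x in lborel. gen_hermite_weight \<gamma> x = 0"
      using integral_nonneg_eq_0_iff_AE[OF int] gen_hermite_weight_nonneg by simp
    moreover have "AE x in lborel. x \<noteq> (0 :: real)"
      by (rule AE_lborel_singleton)
    ultimately have "AE x in (lborel :: real measure). False"
      by eventually_elim (simp add: gen_hermite_weight_def)
    hence "ae_filter (lborel :: real measure) = bot"
      by (simp add: trivial_limit_def[symmetric] eventually_False)
    thus False
      by (simp add: ae_filter_eq_bot_iff)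
  qed
  moreover have "(\<integral>x. gen_hermite_weight \<gamma> x \<partial>lborel) \<ge> 0"
    by (simp add: gen_hermite_weight_nonneg)
  ultimately show ?thesis by simp
qed

section \<open>Translated and rescaled generalized Hermite measures\<close>

definition affine_hermite_measure :: "real \<Rightarrow> real \<Rightarrow> real \<Rightarrow> real \<Rightarrow> real measure" where
  "affine_hermite_measure \<gamma> c d K =
     density lborel (\<lambda>x. ennreal (K * (\<bar>c * (x - d)\<bar> powr \<gamma> * exp (- c\<^sup>2 * (x - d)\<^sup>2))))"

lemma has_density_proportional_to_iff:
  "has_density_proportional_to \<mu> (\<lambda>x. \<bar>c * (x - d)\<bar> powr \<gamma> * exp (- c\<^sup>2 * (x - d)\<^sup>2)) \<longleftrightarrow>
     (\<exists>K>0. \<mu> = affine_hermite_measure \<gamma> c d K)"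
  by (simp add: has_density_proportional_to_def affine_hermite_measure_def)

lemma gen_hermite_measure_eq:
  "gen_hermite_measure \<gamma> = affine_hermite_measure \<gamma> 1 0 (1 / (\<integral>y. gen_hermite_weight \<gamma> y \<partial>lborel))"
  by (simp add: gen_hermite_measure_def affine_hermite_measure_def gen_hermite_weight_def)

context
  fixes \<gamma> c d K :: real
  assumes \<gamma>: "\<gamma> > -1" and c: "c > 0" and K: "K > 0"
begin

abbreviation "\<xi> \<equiv> affine_hermite_measure \<gamma> c d K"

lemma affine_hermite_measure_conv:
  "\<xi> = density lborel (\<lambda>x. ennreal (K * gen_hermite_weight \<gamma> (c * (x - d))))"
  by (simp add: affine_hermite_measure_def gen_hermite_weight_def power_mult_distrib)

lemma sets_affine_hermite_measure [simp, measurable_cong]: "sets \<xi> = sets borel"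
  and space_affine_hermite_measure [simp]: "space \<xi> = UNIV"
  by (simp_all add: affine_hermite_measure_def)

lemma affine_hermite_measure_integral:
  fixes g :: "real \<Rightarrow> real"
  assumes [measurable]: "g \<in> borel_measurable borel"
  shows "integrable \<xi> g \<longleftrightarrow> integrable lborel (\<lambda>x. g (d + x / c) * gen_hermite_weight \<gamma> x)"
    and "(\<integral>x. g x \<partial>\<xi>) = K / c * (\<integral>x. g (d + x / c) * gen_hermite_weight \<gamma> x \<partial>lborel)"
proof -
  let ?h = "\<lambda>x. (K * gen_hermite_weight \<gamma> (c * (x - d))) * g x"
  have nn: "K * gen_hermite_weight \<gamma> (c * (x - d)) \<ge> 0" for x
    using K gen_hermite_weight_nonneg by simp
  have h: "?h (d + (1 / c) * x) = K * (g (d + x / c) * gen_hermite_weight \<gamma> x)" for x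
    using c by (simp add: mult_ac)
  have "integrable \<xi> g \<longleftrightarrow> integrable lborel ?h"
    unfolding affine_hermite_measure_conv using nn by (subst integrable_density) auto
  also have "\<dots> \<longleftrightarrow> integrable lborel (\<lambda>x. ?h (d + (1 / c) * x))"
    by (rule lborel_integrable_real_affine_iff[symmetric]) (use c in simp)
  also have "\<dots> \<longleftrightarrow> integrable lborel (\<lambda>x. g (d + x / c) * gen_hermite_weight \<gamma> x)"
    unfolding h using K by simp
  finally show "integrable \<xi> g \<longleftrightarrow> integrable lborel (\<lambda>x. g (d + x / c) * gen_hermite_weight \<gamma> x)" .
  have "(\<integral>x. g x \<partial>\<xi>) = (\<integral>x. ?h x \<partial>lborel)"
    unfolding affine_hermite_measure_conv using nn by (subst integral_density) auto
  also have "\<dots> = \<bar>1 / c\<bar> *\<^sub>R (\<integral>x. ?h (d + (1 / c) * x) \<partial>lborel)"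
    by (rule lborel_integral_real_affine) (use c in simp)
  finally show "(\<integral>x. g x \<partial>\<xi>) = K / c * (\<integral>x. g (d + x / c) * gen_hermite_weight \<gamma> x \<partial>lborel)"
    unfolding h using c by simp
qed

lemma prob_on_reals_affine_hermite_measure:
  assumes "K / c * (\<integral>x. gen_hermite_weight \<gamma> x \<partial>lborel) = 1"
  shows "prob_on_reals \<xi>"
proof -
  have "integrable \<xi> (\<lambda>x. 1 :: real)"
    using integrable_power_gen_hermite_weight[OF \<gamma>, of 0] by (subst affine_hermite_measure_integral) simp_all
  hence "emeasure \<xi> UNIV < \<infinity>"
    by (simp add: integrable_iff_bounded)
  moreover have "(\<integral>x. 1 \<partial>\<xi>) = K / c * (\<integral>x. 1 * gen_hermite_weight \<gamma> x \<partial>lborel)"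
    by (rule affine_hermite_measure_integral) simp
  hence "measure \<xi> UNIV = 1"
    using assms by (simp only: mult_1) simp
  ultimately have "emeasure \<xi> UNIV = 1"
    by (simp add: emeasure_eq_ennreal_measure)
  thus ?thesis
    unfolding prob_on_reals_def by (auto intro!: prob_spaceI)
qed

lemma integrable_exp_affine_hermite_measure: "integrable \<xi> (\<lambda>x. exp (t * \<bar>x\<bar>))"
proof (subst affine_hermite_measure_integral)
  show "integrable lborel (\<lambda>x. exp (t * \<bar>d + x / c\<bar>) * gen_hermite_weight \<gamma> x)"
  proof (rule Bochner_Integration.integrable_bound)
    show "integrable lborel (\<lambda>x. exp (\<bar>t\<bar> * \<bar>d\<bar>) * (exp ((\<bar>t\<bar> / c) * \<bar>x\<bar>) * gen_hermite_weight \<gamma> x))"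
      by (intro integrable_mult_right integrable_exp_gen_hermite_weight \<gamma>)
    have "norm (exp (t * \<bar>d + x / c\<bar>) * gen_hermite_weight \<gamma> x)
        \<le> norm (exp (\<bar>t\<bar> * \<bar>d\<bar>) * (exp ((\<bar>t\<bar> / c) * \<bar>x\<bar>) * gen_hermite_weight \<gamma> x))" for x
    proof -
      have "t * \<bar>d + x / c\<bar> \<le> \<bar>t\<bar> * (\<bar>d\<bar> + \<bar>x\<bar> / c)"
        using abs_triangle_ineq[of d "x / c"] c by (intro mult_mono) (auto simp: abs_divide)
      hence "exp (t * \<bar>d + x / c\<bar>) \<le> exp (\<bar>t\<bar> * \<bar>d\<bar>) * exp ((\<bar>t\<bar> / c) * \<bar>x\<bar>)"
        by (simp add: exp_add[symmetric] distrib_left)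
      from mult_right_mono[OF this gen_hermite_weight_nonneg[of \<gamma> x]] show ?thesis
        by (simp add: abs_mult gen_hermite_weight_nonneg mult.assoc)
    qed
    thus "AE x in lborel. norm (exp (t * \<bar>d + x / c\<bar>) * gen_hermite_weight \<gamma> x)
        \<le> norm (exp (\<bar>t\<bar> * \<bar>d\<bar>) * (exp ((\<bar>t\<bar> / c) * \<bar>x\<bar>) * gen_hermite_weight \<gamma> x))"
      by simp
  qed measurable
qed measurable

lemma integrable_power_affine_hermite_measure: "integrable \<xi> (\<lambda>x. x ^ k)"
proof (rule Bochner_Integration.integrable_bound)
  show "integrable \<xi> (\<lambda>x. fact k * exp (1 * \<bar>x\<bar>))"
    by (intro integrable_mult_right integrable_exp_affine_hermite_measure)
  show "AE x in \<xi>. norm (x ^ k) \<le> norm (fact k * exp (1 * \<bar>x\<bar>))"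
    using power_le_fact_mult_exp[of "\<bar>_\<bar>" k] by (simp add: power_abs)
qed measurable

text \<open>The measure has a density, so a finite support would be a null set, as is its
  complement, contradicting total mass 1.\<close>

lemma infinite_support_affine_hermite_measure:
  assumes "prob_on_reals \<xi>"
  shows "infinite (measure_support \<xi>)"
proof
  assume fin: "finite (measure_support \<xi>)"
  have "measure_support \<xi> \<in> null_sets lborel"
    using fin by (rule finite_imp_null_set_lborel)
  hence "AE x in lborel. x \<notin> measure_support \<xi>"
    by (rule AE_not_in)
  hence "AE x in \<xi>. x \<notin> measure_support \<xi>"
    unfolding affine_hermite_measure_conv by (subst AE_density) auto
  moreover have "AE x in \<xi>. x \<notin> - measure_support \<xi>"
    using measure_support_compl_null[of \<xi>] by (intro AE_not_in) (auto simp: null_sets_def borel_open)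
  ultimately have "AE x in \<xi>. False"
    by eventually_elim simp
  thus False
    using assms by (simp add: prob_on_reals_def prob_space.AE_False)
qed

text \<open>Substituting d + x / c leaves x d/dx unchanged and turns 2 x^2 into 2 c^2 (x - d)^2,
  whence the scale 1 / (2 c^2). The mean is d because the weight is even about d.\<close>

lemma recurrence_coeffs_affine_hermite_measure:
  assumes prob: "prob_on_reals \<xi>" and H: "hermite_coeffs \<gamma> (1 / (2 * c\<^sup>2)) d a b"
  shows "recurrence_coeffs \<xi> a b"
proof -
  interpret finite_moments \<xi>
    by unfold_locales (use prob integrable_power_affine_hermite_measure in auto)
  have L: "L p = K / c * (\<integral>x. poly (p \<circ>\<^sub>p [:d, 1 / c:]) x * gen_hermite_weight \<gamma> x \<partial>lborel)" for p
    unfolding poly_integral_def by (subst affine_hermite_measure_integral) (simp_all add: poly_pcompose)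
  have int: "integrable lborel (\<lambda>x. poly p x * gen_hermite_weight \<gamma> x)" for p
    unfolding poly_altdef sum_distrib_right mult.assoc
    by (intro Bochner_Integration.integrable_sum integrable_mult_right integrable_power_gen_hermite_weight \<gamma>)
  show ?thesis
  proof (rule recurrence_coeffs_of_pearson[OF H])
    have "integrable lborel (\<lambda>x. indicator {0..} x *\<^sub>R (x / c * gen_hermite_weight \<gamma> x))"
      using int[of "[:0, 1 / c:]"] by (intro integrable_mult_indicator) simp_all
    from has_bochner_integral_odd_function[OF has_bochner_integral_integrable[OF this]]
    have "(\<integral>x. x / c * gen_hermite_weight \<gamma> x \<partial>lborel) = 0"
      by (simp add: gen_hermite_weight_minus has_bochner_integral_iff)
    thus "L [:- d, 1:] = 0"
      by (simp add: L pcompose_pCons)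
  next
    fix p :: "real poly"
    let ?q = "p \<circ>\<^sub>p [:d, 1 / c:]" and ?w = "gen_hermite_weight \<gamma>"
    let ?g = "\<lambda>x. (x * poly (pderiv ?q) x + (1 + \<gamma>) * poly ?q x) * ?w x"
    have "has_bochner_integral lborel (\<lambda>x. (x * poly (pderiv ?q) x + (1 + \<gamma>) * poly ?q x
        - 2 * x\<^sup>2 * poly ?q x) * ?w x) 0"
      using gen_hermite_weight_pearson[OF \<gamma>, of ?q 0] by simp
    moreover have i1: "integrable lborel ?g"
      using int[of "[:0, 1:] * pderiv ?q + smult (1 + \<gamma>) ?q"] by (simp add: algebra_simps)
    moreover have i2: "integrable lborel (\<lambda>x. x\<^sup>2 * poly ?q x * ?w x)"
      using int[of "[:0, 1:] ^ 2 * ?q"] by (simp only: poly_mult poly_power poly_pCons poly_0) simp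
    ultimately have "(\<integral>x. ?g x \<partial>lborel) = 2 * (\<integral>x. x\<^sup>2 * poly ?q x * ?w x \<partial>lborel)"
      by (simp add: has_bochner_integral_iff left_diff_distrib mult.assoc)
    moreover have "L ([:- d, 1:] * pderiv p + smult (\<gamma> + 1) p) = K / c * (\<integral>x. ?g x \<partial>lborel)"
      unfolding L
      by (simp add: poly_pcompose pderiv_pcompose pderiv_pCons add.commute del: mult_pCons_left)
    moreover have "L ([:- d, 1:] ^ 2 * p) = K / c * (\<integral>x. (1 / c\<^sup>2) * (x\<^sup>2 * poly ?q x * ?w x) \<partial>lborel)"
      unfolding L by (simp add: poly_pcompose power_divide)
    ultimately show "1 / (2 * c\<^sup>2) * L ([:- d, 1:] * pderiv p + smult (\<gamma> + 1) p) = L ([:- d, 1:] ^ 2 * p)"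
      by simp
  qed
qed

end

section \<open>Determinacy and the characterization\<close>

lemma prob_on_reals_imp_real_distribution: "prob_on_reals M \<Longrightarrow> real_distribution M"
  by (simp add: prob_on_reals_def real_distribution_def real_distribution_axioms_def)

text \<open>The Taylor remainders of both characteristic functions are bounded by the same even
  moments, so exponential integrability of one measure controls both, and Levy uniqueness
  applies.\<close>

lemma moment_determinacy:
  assumes M: "prob_on_reals M" and N: "prob_on_reals N"
    and iM: "\<And>k. integrable M (\<lambda>x. x ^ k)" and iN: "\<And>k. integrable N (\<lambda>x. x ^ k)"
    and eq: "\<And>k. (\<integral>x. x ^ k \<partial>M) = (\<integral>x. x ^ k \<partial>N)"
    and exp: "\<And>t. integrable N (\<lambda>x. exp (t * \<bar>x\<bar>))"
  shows "M = N"
proof (rule Levy_uniqueness)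
  show M': "real_distribution M" and N': "real_distribution N"
    using M N by (simp_all add: prob_on_reals_imp_real_distribution)
  have setsN [simp, measurable_cong]: "sets N = sets borel"
    using N by (simp add: prob_on_reals_def)
  show "char M = char N"
  proof
    fix t :: real
    let ?T = "\<lambda>n x :: real. \<bar>t * x\<bar> ^ n / fact n"
    have bound: "?T n x \<le> exp (\<bar>t\<bar> * \<bar>x\<bar>)" for n and x :: real
      using power_le_fact_mult_exp[of "\<bar>t * x\<bar>" n] by (simp add: abs_mult field_simps)
    have "(\<lambda>n. \<integral>x. ?T n x \<partial>N) \<longlonglongrightarrow> (\<integral>x. 0 \<partial>N)"
    proof (rule integral_dominated_convergence[where w = "\<lambda>x. exp (\<bar>t\<bar> * \<bar>x\<bar>)"])
      have "(\<lambda>n. ?T n x) \<longlonglongrightarrow> 0" for x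
        using summable_LIMSEQ_zero[OF summable_exp[of "\<bar>t * x\<bar>"]] by (simp add: field_simps)
      thus "AE x in N. (\<lambda>n. ?T n x) \<longlonglongrightarrow> 0"
        by simp
      show "AE x in N. norm (?T n x) \<le> exp (\<bar>t\<bar> * \<bar>x\<bar>)" for n
        using bound[of _ n] by simp
    qed (use exp in \<open>auto intro: exp\<close>)
    hence lim: "(\<lambda>n. \<integral>x. ?T n x \<partial>N) \<longlonglongrightarrow> 0"
      by simp
    \<comment> \<open>Even orders only: there absolute moments are ordinary moments, hence common to
      \<open>M\<close> and \<open>N\<close>.\<close>
    have "(\<lambda>k. 4 * (\<integral>x. ?T (2 * k) x \<partial>N)) \<longlonglongrightarrow> 4 * 0"
      by (intro tendsto_mult tendsto_const LIMSEQ_subseq_LIMSEQ[OF lim, unfolded comp_def])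
         (auto simp: strict_mono_def)
    moreover have "cmod (char M t - char N t) \<le> 4 * (\<integral>x. ?T (2 * k) x \<partial>N)" for k
    proof -
      let ?S = "\<lambda>K. \<Sum>i\<le>2 * k. ((\<i> * t) ^ i / fact i) * complex_of_real (\<integral>x. x ^ i \<partial>K)"
      have T: "(2 * \<bar>t\<bar> ^ (2 * k) / fact (2 * k)) * (\<integral>x. \<bar>x\<bar> ^ (2 * k) \<partial>N) = 2 * (\<integral>x. ?T (2 * k) x \<partial>N)"
        by (simp add: abs_mult power_mult_distrib)
      have mom: "(\<integral>x. \<bar>x\<bar> ^ (2 * k) \<partial>M) = (\<integral>x. \<bar>x\<bar> ^ (2 * k) \<partial>N)"
        by (simp add: power_even_abs eq)
      have "cmod (char M t - ?S M) \<le> (2 * \<bar>t\<bar> ^ (2 * k) / fact (2 * k)) * (\<integral>x. \<bar>x\<bar> ^ (2 * k) \<partial>M)"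
        by (rule real_distribution.char_approx1[OF M' iM])
      hence 1: "cmod (char M t - ?S N) \<le> 2 * (\<integral>x. ?T (2 * k) x \<partial>N)"
        unfolding mom T eq .
      have 2: "cmod (char N t - ?S N) \<le> 2 * (\<integral>x. ?T (2 * k) x \<partial>N)"
        unfolding T[symmetric] by (rule real_distribution.char_approx1[OF N' iN])
      have "cmod (char M t - char N t) \<le> cmod (char M t - ?S N) + cmod (char N t - ?S N)"
        using norm_triangle_ineq4[of "char M t - ?S N" "char N t - ?S N"] by simp
      thus ?thesis
        using 1 2 by linarith
    qed
    ultimately have "cmod (char M t - char N t) \<le> 4 * 0"
      by (intro LIMSEQ_le_const) auto
    thus "char M t = char N t"
      by simp
  qed
qed

text \<open>Both functionals send P_0 = 1 to 1 and every later P_n to 0, and these polynomials span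
  all polynomials.\<close>

lemma moments_eq_of_same_orthogonal_polys:
  assumes "finite_moments M" "finite_moments N"
    and P: "monic_orthogonal_polys M P" "monic_orthogonal_polys N P"
  shows "poly_integral M q = poly_integral N q"
proof (induction "degree q" arbitrary: q rule: less_induct)
  case less
  interpret M: finite_moments M by fact
  interpret N: finite_moments N by fact
  have deg: "degree (P n) = n" "coeff (P n) n = 1" for n
    using P(1) unfolding M.monic_orthogonal_polys_iff by metis+
  obtain e where "P 0 = [:e:]"
    using deg(1)[of 0] by (rule degree_eq_zeroE)
  hence P0: "P 0 = 1"
    using deg(2)[of 0] by simp
  show ?case
  proof (cases "degree q = 0")
    case True
    then obtain c where "q = [:c:]"
      by (rule degree_eq_zeroE)
    thus ?thesis
      by simp
  next
    case False
    let ?r = "q - smult (lead_coeff q) (P (degree q))"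
    have "degree ?r \<le> degree q"
      using deg by (intro degree_diff_le order.trans[OF degree_smult_le]) auto
    moreover have "coeff ?r (degree q) = 0"
      using deg by simp
    ultimately have "degree ?r < degree q"
      using False by (metis leading_coeff_0_iff degree_0 order_le_less neq0_conv)
    hence "poly_integral M ?r = poly_integral N ?r"
      by (rule less)
    moreover have "poly_integral M (P (degree q) * P 0) = 0" "poly_integral N (P (degree q) * P 0) = 0"
      using P False unfolding M.monic_orthogonal_polys_iff N.monic_orthogonal_polys_iff by blast+
    ultimately show ?thesis
      by (simp add: P0)
  qed
qed

theorem theorem2p1:
  "(\<forall>\<mu> :: real measure. prob_on_reals \<mu> \<and> infinite_support_finite_moments \<mu> \<longrightarrow>
      (property_P \<mu> \<longleftrightarrow>
        (\<exists>\<gamma> c d :: real. \<gamma> > -1 \<and> c > 0 \<and>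
           has_density_proportional_to \<mu>
             (\<lambda>x. \<bar>c * (x - d)\<bar> powr \<gamma> * exp (- c\<^sup>2 * (x - d)\<^sup>2))))) \<and>
   (\<forall>\<gamma> :: real. \<gamma> > -1 \<longrightarrow>
      (\<forall>m::nat. m \<ge> 1 \<longrightarrow>
        (let \<nu> = reversed_measure (gen_hermite_measure \<gamma>) (2 * m);
             S = measure_support \<nu>
         in 0 \<in> S \<and> card (S - {0}) = 2 * m \<and>
            (\<forall>x\<in>S - {0}. measure \<nu> {0} = (\<gamma> + 1) * measure \<nu> {x}))))"
proof (intro conjI allI impI)
  fix \<mu> :: "real measure"
  assume \<mu>: "prob_on_reals \<mu> \<and> infinite_support_finite_moments \<mu>"
  interpret infinite_moments \<mu>
    using \<mu> by unfold_locales (auto simp: infinite_support_finite_moments_def)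
  show "property_P \<mu> \<longleftrightarrow> (\<exists>\<gamma> c d :: real. \<gamma> > -1 \<and> c > 0 \<and>
           has_density_proportional_to \<mu>
             (\<lambda>x. \<bar>c * (x - d)\<bar> powr \<gamma> * exp (- c\<^sup>2 * (x - d)\<^sup>2)))" (is "_ \<longleftrightarrow> ?rhs")
    unfolding has_density_proportional_to_iff
  proof
    assume P: "property_P \<mu>"
    obtain a b where ab: "recurrence_coeffs \<mu> a b"
      using recurrence_coeffs_exist by blast
    from hermite_coeffs_of_property_P[OF ab P] obtain \<gamma> s d
      where \<gamma>: "\<gamma> > -1" and s: "s > 0" and H: "hermite_coeffs \<gamma> s d a b"
      by blast
    \<comment> \<open>c is chosen to solve s = 1 / (2 c^2), and \<open>K\<close> to give total mass
      1.\<close>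
    define c where "c = sqrt (1 / (2 * s))"
    define K where "K = c / (\<integral>x. gen_hermite_weight \<gamma> x \<partial>lborel)"
    have c: "c > 0" and s_eq: "s = 1 / (2 * c\<^sup>2)"
      using s by (simp_all add: c_def field_simps)
    have K: "K > 0" and norm: "K / c * (\<integral>x. gen_hermite_weight \<gamma> x \<partial>lborel) = 1"
      using c gen_hermite_weight_integral_pos[OF \<gamma>] by (simp_all add: K_def)
    let ?\<xi> = "affine_hermite_measure \<gamma> c d K"
    have prob\<xi>: "prob_on_reals ?\<xi>"
      by (rule prob_on_reals_affine_hermite_measure[OF \<gamma> c K norm])
    note mom\<xi> = integrable_power_affine_hermite_measure[OF \<gamma> c K]
    interpret \<xi>: finite_moments ?\<xi>
      by unfold_locales (fact prob\<xi>, fact mom\<xi>)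
    have "recurrence_coeffs ?\<xi> a b"
      using H unfolding s_eq by (rule recurrence_coeffs_affine_hermite_measure[OF \<gamma> c K prob\<xi>])
    hence "poly_integral \<mu> q = poly_integral ?\<xi> q" for q
      using ab unfolding recurrence_coeffs_iff \<xi>.recurrence_coeffs_iff
      by (intro moments_eq_of_same_orthogonal_polys[of _ _ "recurrence_poly a b"])
         (simp_all add: finite_moments_axioms \<xi>.finite_moments_axioms)
    from this[of "monom 1 _"] have "(\<integral>x. x ^ k \<partial>\<mu>) = (\<integral>x. x ^ k \<partial>?\<xi>)" for k
      by (simp add: poly_integral_def poly_monom)
    hence "\<mu> = ?\<xi>"
      using prob prob\<xi> moments mom\<xi> integrable_exp_affine_hermite_measure[OF \<gamma> c K]
      by (intro moment_determinacy)
    thus "\<exists>\<gamma> c d. \<gamma> > -1 \<and> c > 0 \<and> (\<exists>K>0. \<mu> = affine_hermite_measure \<gamma> c d K)"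
      using \<gamma> c K by blast
  next
    assume "\<exists>\<gamma> c d. \<gamma> > -1 \<and> c > 0 \<and> (\<exists>K>0. \<mu> = affine_hermite_measure \<gamma> c d K)"
    then obtain \<gamma> c d K where \<gamma>: "\<gamma> > -1" and c: "c > 0" and K: "K > 0"
      and eq: "\<mu> = affine_hermite_measure \<gamma> c d K"
      by blast
    obtain a b where H: "hermite_coeffs \<gamma> (1 / (2 * c\<^sup>2)) d a b"
      using ex_hermite_coeffs by blast
    have "recurrence_coeffs \<mu> a b"
      unfolding eq by (rule recurrence_coeffs_affine_hermite_measure[OF \<gamma> c K _ H]) (use prob eq in simp)
    thus "property_P \<mu>"
      using H \<gamma> by (rule property_P_of_hermite_coeffs) (use c in simp)
  qed
next
  fix \<gamma> :: real and m :: nat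
  assume \<gamma>: "\<gamma> > -1"
  define K where "K = 1 / (\<integral>x. gen_hermite_weight \<gamma> x \<partial>lborel)"
  have c: "(1 :: real) > 0"
    by simp
  have K: "K > 0" and norm: "K / 1 * (\<integral>x. gen_hermite_weight \<gamma> x \<partial>lborel) = 1"
    using gen_hermite_weight_integral_pos[OF \<gamma>] by (simp_all add: K_def)
  have eq: "gen_hermite_measure \<gamma> = affine_hermite_measure \<gamma> 1 0 K"
    unfolding gen_hermite_measure_eq K_def ..
  have prob: "prob_on_reals (affine_hermite_measure \<gamma> 1 0 K)"
    by (rule prob_on_reals_affine_hermite_measure[OF \<gamma> c K norm])
  interpret infinite_moments "affine_hermite_measure \<gamma> 1 0 K"
    by unfold_locales (fact prob, rule integrable_power_affine_hermite_measure[OF \<gamma> c K],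
        rule infinite_support_affine_hermite_measure[OF \<gamma> c K prob])
  \<comment> \<open>The measure xi_gamma is the case c = 1, d = 0, with scale s = 1/2.\<close>
  obtain a b where H: "hermite_coeffs \<gamma> (1 / (2 * 1\<^sup>2)) 0 a b"
    using ex_hermite_coeffs by blast
  have ab: "recurrence_coeffs (affine_hermite_measure \<gamma> 1 0 K) a b"
    by (rule recurrence_coeffs_affine_hermite_measure[OF \<gamma> c K prob H])
  have s: "1 / (2 * 1\<^sup>2) > (0 :: real)"
    by simp
  show "let \<nu> = reversed_measure (gen_hermite_measure \<gamma>) (2 * m);
             S = measure_support \<nu>
         in 0 \<in> S \<and> card (S - {0}) = 2 * m \<and>
            (\<forall>x\<in>S - {0}. measure \<nu> {0} = (\<gamma> + 1) * measure \<nu> {x})"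
    unfolding Let_def eq
    by (intro conjI ballI reversed_measure_even_weights[OF ab H \<gamma> s])
qed

end
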